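(* Let $q$ be a complex number with $0<|q|<1$, fix a fifth root $q^{1/5}$ of $q$, and for each positive integer $n$ put $R(q^n):=(q^{1/5})^n\,T(q^n)$, where $T$ is as in the context. Then \begin{align*} &R(q)R(q^4)=\frac{R(q^5)+R(q^{20})-R(q^5)R(q^{20})}{1+R(q^{5})+R(q^{20})},\\ &\frac{R^2(q)R(q^{2})}{R(q^{4})}=R(q^{5})\,\frac{R(q^{10})-R(q^{5})R(q^{10})+R(q^{20})}{R(q^{5})R(q^{10})+R(q^{20})+R(q^{5})R(q^{20})},\\ &\frac{1}{R(q)R^2(q^{2})}-R(q)R^2(q^{2})=\frac{N}{D}, \end{align*} where \[ D=R(q^{5})\left(1+R(q^{5})R^2(q^{10})-R^2(q^{5})R^4(q^{10})\right) \] and \begin{align*} N&=1+R(q^{5})+R^2(q^{5})+2R(q^{5})R(q^{10})+2R^2(q^{5})R(q^{10})-2R(q^{5})R^2(q^{10})\\ &\quad+2R^3(q^{5})R^2(q^{10})-2R^2(q^{5})R^3(q^{10})+2R^3(q^{5})R^3(q^{10})+R^2(q^{5})R^4(q^{10})\\ &\quad-R^3(q^{5})R^4(q^{10})+R^4(q^{5})R^4(q^{10}). \end{align*}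
   Context: For complex $a$ and $|q|<1$, $(a;q)_\infty:=\prod_{k=0}^{\infty}(1-aq^k)$. The Rogers–Ramanujan functions are $G(q):=\frac{1}{(q;q^5)_\infty(q^4;q^5)_\infty}$ and $H(q):=\frac{1}{(q^2;q^5)_\infty(q^3;q^5)_\infty}$, and $T(q):=\frac{H(q)}{G(q)}=\frac{(q;q^5)_\infty(q^4;q^5)_\infty}{(q^2;q^5)_\infty(q^3;q^5)_\infty}$. The Rogers–Ramanujan continued fraction $R(q)=\cfrac{q^{1/5}}{1+\cfrac{q}{1+\cfrac{q^2}{1+\cdots}}}$ satisfies $R(q)=q^{1/5}T(q)$; in the statement, $R(q^n)$ means $(q^{1/5})^nT(q^n)$ for the fixed choice of $q^{1/5}$, and $R^k(x)$ means $(R(x))^k$. *)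

theory Defs
  imports "HOL-Analysis.Analysis"
begin

text \<open>Only meaningful for \<open>norm q < 1\<close>, where the product converges absolutely
  for every \<open>a\<close> (its value being \<open>0\<close> if some factor vanishes).\<close>

definition qpochhammer_inf :: "complex \<Rightarrow> complex \<Rightarrow> complex" where
  "qpochhammer_inf a q = (\<Prod>k. 1 - a * q ^ k)"

definition rogers_ramanujan_G :: "complex \<Rightarrow> complex" where
  "rogers_ramanujan_G q = 1 / (qpochhammer_inf q (q ^ 5) * qpochhammer_inf (q ^ 4) (q ^ 5))"

definition rogers_ramanujan_H :: "complex \<Rightarrow> complex" where
  "rogers_ramanujan_H q = 1 / (qpochhammer_inf (q ^ 2) (q ^ 5) * qpochhammer_inf (q ^ 3) (q ^ 5))"

text \<open>The Rogers--Ramanujan continued fraction without its factor \<open>q\<close> to the power \<open>1/5\<close>;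
  that factor depends on the choice of a fifth root, so it is left to the user of \<open>T\<close>.\<close>

definition rogers_ramanujan_T :: "complex \<Rightarrow> complex" where
  "rogers_ramanujan_T q = rogers_ramanujan_H q / rogers_ramanujan_G q"

end

theory Submission
  imports Defs "HOL-Complex_Analysis.Complex_Analysis"
begin

text \<open>
  Let \<open>r(s) = s T(s\<^sup>5)\<close>, so that \<open>R(q\<^sup>n) = r(s\<^sup>n)\<close>, and put \<open>k(s) = r(s) r(s\<^sup>2)\<^sup>2\<close>. The Jacobi triple product
  yields Weierstrass' three-term theta identity, whose instances for the bases \<open>q\<^bsup>10\<^esup>\<close> and \<open>q\<^bsup>20\<^esup>\<close> give the
  modular equations relating \<open>r(s)\<close>, \<open>r(s\<^sup>2)\<close> and \<open>r(s\<^sup>4)\<close>. Dissecting the theta series at a fifth root of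
  unity \<open>w \<noteq> 1\<close> modulo 5 writes \<open>1 + (w\<^sup>2 + w\<^sup>3) r(q)\<close> as an infinite product; multiplying over the five
  choices of \<open>s\<close> yields \<open>1 + (w\<^sup>2 + w\<^sup>3)\<^sup>5 r(s)\<^sup>5 = M (1 + (w\<^sup>2 + w\<^sup>3) r(s\<^sup>5))\<^sup>5\<close>, hence \<open>r(s)\<^sup>5\<close> as a rational
  function of \<open>r(s\<^sup>5)\<close>. These algebraic relations determine \<open>k(s)\<^sup>5\<close> and, by comparing the behaviour at \<open>0\<close>,
  \<open>k(s)\<close> itself as a rational function of \<open>r(s\<^sup>5)\<close> and \<open>r(s\<^bsup>10\<^esup>)\<close>. All three identities are then
  polynomial consequences near \<open>0\<close>, extended to the disc by the identity theorem; the denominators do not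
  vanish because neither \<open>1 - r - r\<^sup>2\<close> nor \<open>1 - 11 r\<^sup>5 - r\<^bsup>10\<^esup>\<close> does.
\<close>

section \<open>The q-Pochhammer symbol\<close>

lemma prod_lessThan_add:
  "(\<Prod>k<m + n::nat. f k :: 'a :: comm_monoid_mult) = (\<Prod>k<m. f k) * (\<Prod>k<n. f (m + k))"
  by (induction n) (simp_all add: mult.assoc)

lemma convergent_prod_qpochhammer:
  assumes "norm (q :: complex) < 1"
  shows "convergent_prod (\<lambda>k. 1 - a * q ^ k)"
proof -
  have "summable (\<lambda>k. norm a * norm q ^ k)"
    using assms by (intro summable_mult summable_geometric) auto
  then have "summable (\<lambda>k. norm ((1 - a * q ^ k) - 1))"
    by (simp add: norm_mult norm_power)
  then show ?thesis
    by (intro abs_convergent_prod_imp_convergent_prod summable_imp_abs_convergent_prod)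
qed

lemma qpochhammer_inf_LIMSEQ:
  assumes "norm q < 1"
  shows "(\<lambda>n. \<Prod>k<n. 1 - a * q ^ k) \<longlonglongrightarrow> qpochhammer_inf a q"
  using convergent_prod_LIMSEQ[OF convergent_prod_qpochhammer[OF assms, of a]]
  unfolding qpochhammer_inf_def by (subst (asm) lessThan_Suc_atMost [symmetric], subst (asm) filterlim_sequentially_Suc)

lemma qpochhammer_inf_nonzero:
  assumes "norm q < 1" "\<And>k. a * q ^ k \<noteq> 1"
  shows "qpochhammer_inf a q \<noteq> 0"
  unfolding qpochhammer_inf_def
  by (rule prodinf_nonzero[OF convergent_prod_qpochhammer[OF assms(1)]]) (use assms(2) in \<open>metis right_minus_eq\<close>)

lemma qpochhammer_inf_nonzero':
  assumes "norm q < 1" "norm a < 1"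
  shows "qpochhammer_inf a q \<noteq> 0"
proof (rule qpochhammer_inf_nonzero[OF assms(1)])
  fix k
  have "norm (a * q ^ k) \<le> norm a * 1"
    unfolding norm_mult norm_power using assms by (intro mult_left_mono power_le_one) auto
  then show "a * q ^ k \<noteq> 1" using assms(2) by auto
qed

lemma qpochhammer_inf_0_right [simp]: "qpochhammer_inf 0 q = 1"
  by (simp add: qpochhammer_inf_def)

lemma qpochhammer_inf_rec:
  assumes "norm q < 1"
  shows "qpochhammer_inf a q = (1 - a) * qpochhammer_inf (a * q) q"
proof -
  have *: "(\<Prod>k<Suc n. 1 - a * q ^ k) = (1 - a) * (\<Prod>k<n. 1 - a * q * q ^ k)" for n
    by (subst prod.lessThan_Suc_shift) (simp add: mult_ac)
  have "(\<lambda>n. \<Prod>k<Suc n. 1 - a * q ^ k) \<longlonglongrightarrow> (1 - a) * qpochhammer_inf (a * q) q"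
    unfolding * by (intro tendsto_intros qpochhammer_inf_LIMSEQ assms)
  moreover have "(\<lambda>n. \<Prod>k<Suc n. 1 - a * q ^ k) \<longlonglongrightarrow> qpochhammer_inf a q"
    using qpochhammer_inf_LIMSEQ[OF assms] by (subst filterlim_sequentially_Suc)
  ultimately show ?thesis using LIMSEQ_unique by blast
qed

text \<open>Sort the factors by \<open>k\<close> modulo \<open>m\<close>: the partial product of
  length \<open>m * n\<close> regroups exactly into \<open>m\<close> partial products of length
  \<open>n\<close>, and the limit is taken along this subsequence.\<close>

lemma qpochhammer_inf_split:
  assumes "norm q < 1" "m > 0"
  shows "qpochhammer_inf a q = (\<Prod>r<m. qpochhammer_inf (a * q ^ r) (q ^ m))"
proof -
  have qm: "norm (q ^ m) < 1"
    using assms by (simp add: norm_power power_less_one_iff)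
  have *: "(\<Prod>k<m * n. 1 - a * q ^ k) = (\<Prod>r<m. \<Prod>k<n. 1 - a * q ^ r * (q ^ m) ^ k)" for n
  proof (induction n)
    case (Suc n)
    have "(\<Prod>k<m * Suc n. 1 - a * q ^ k)
        = (\<Prod>k<m * n. 1 - a * q ^ k) * (\<Prod>k<m. 1 - a * q ^ (m * n + k))"
      unfolding mult_Suc_right add.commute[of m] by (rule prod_lessThan_add)
    then show ?case
      by (simp add: Suc.IH prod.distrib power_add power_mult[symmetric] mult_ac)
  qed simp
  have "(\<lambda>n. \<Prod>k<m * n. 1 - a * q ^ k) \<longlonglongrightarrow> (\<Prod>r<m. qpochhammer_inf (a * q ^ r) (q ^ m))"
    unfolding * by (intro tendsto_intros qpochhammer_inf_LIMSEQ qm)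
  moreover have "filterlim (\<lambda>n. m * n) at_top at_top"
    by (rule filterlim_subseq) (use assms in \<open>auto intro!: strict_monoI\<close>)
  then have "(\<lambda>n. \<Prod>k<m * n. 1 - a * q ^ k) \<longlonglongrightarrow> qpochhammer_inf a q"
    by (rule filterlim_compose[OF qpochhammer_inf_LIMSEQ[OF assms(1)]])
  ultimately show ?thesis using LIMSEQ_unique by blast
qed

text \<open>As 5 is prime, \<open>w\<close> is primitive and its powers are all fifth roots of
  unity. The expansion only needs that they sum to 0.\<close>

lemma prod_root_of_unity_5:
  fixes w b :: complex
  assumes "w ^ 5 = 1" "w \<noteq> 1"
  shows "(\<Prod>i<5. 1 - w ^ i * b) = 1 - b ^ 5"
proof -
  have "(w - 1) * (1 + w + w^2 + w^3 + w^4) = 0"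
    using assms(1) by algebra
  then have 1: "1 + w + w^2 + w^3 + w^4 = 0"
    using assms(2) by simp
  have "(\<Prod>i<5. 1 - w ^ i * b) = (1 - b) * (1 - w * b) * (1 - w^2 * b) * (1 - w^3*b) * (1 - w^4*b)"
    by (simp add: eval_nat_numeral)
  also have "\<dots> = 1 - b ^ 5"
    using 1 assms(1) by algebra
  finally show ?thesis .
qed

lemma prod_qpochhammer_root_of_unity_5:
  assumes "w ^ 5 = 1" "w \<noteq> 1" "norm q < 1"
  shows "(\<Prod>i<5. qpochhammer_inf (w ^ i * b) q) = qpochhammer_inf (b ^ 5) (q ^ 5)"
proof -
  have q5: "norm (q ^ 5) < 1"
    using assms by (simp add: norm_power power_less_one_iff)
  have *: "(\<Prod>i<5. \<Prod>k<n. 1 - w ^ i * b * q ^ k) = (\<Prod>k<n. 1 - b ^ 5 * (q ^ 5) ^ k)" for n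
  proof (subst prod.swap, rule prod.cong[OF refl])
    fix k
    show "(\<Prod>i<5. 1 - w ^ i * b * q ^ k) = 1 - b ^ 5 * (q ^ 5) ^ k"
      using prod_root_of_unity_5[OF assms(1,2), of "b * q ^ k"]
      by (simp add: mult.assoc power_mult_distrib power_mult[symmetric] mult.commute[of k])
  qed
  have "(\<lambda>n. \<Prod>i<5. \<Prod>k<n. 1 - w ^ i * b * q ^ k) \<longlonglongrightarrow> (\<Prod>i<5. qpochhammer_inf (w ^ i * b) q)"
    by (intro tendsto_intros qpochhammer_inf_LIMSEQ assms)
  moreover have "(\<lambda>n. \<Prod>i<5. \<Prod>k<n. 1 - w ^ i * b * q ^ k) \<longlonglongrightarrow> qpochhammer_inf (b ^ 5) (q ^ 5)"
    unfolding * by (intro qpochhammer_inf_LIMSEQ q5)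
  ultimately show ?thesis using LIMSEQ_unique by blast
qed

text \<open>The partial products are polynomials, and they converge uniformly on a closed disc
  around each point by the M-test with a geometric majorant.\<close>

lemma holomorphic_qpochhammer_inf:
  assumes "m > 0"
  shows "(\<lambda>q. qpochhammer_inf (q ^ a) (q ^ m)) holomorphic_on ball 0 1"
proof (rule holomorphic_uniform_sequence)
  let ?P = "\<lambda>n q. \<Prod>k<n. 1 - q ^ a * (q ^ m) ^ k :: complex"
  show "?P n holomorphic_on ball 0 1" for n
    by (intro holomorphic_intros)
  fix x :: complex assume x: "x \<in> ball 0 1"
  define d where "d = (1 - norm x) / 2"
  have d: "d > 0" "norm x + d < 1" using x by (auto simp: d_def field_simps)
  have nq: "norm q \<le> norm x + d" if "q \<in> cball x d" for q
    using that norm_triangle_sub[of q x] by (simp add: dist_norm norm_minus_commute)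
  then have sub: "cball x d \<subseteq> ball 0 1"
    using d by force
  have "uniformly_convergent_on (cball x d) ?P"
  proof (rule uniformly_convergent_on_prod')
    show "uniformly_convergent_on (cball x d) (\<lambda>N q. \<Sum>n<N. norm (1 - q ^ a * (q ^ m) ^ n - 1))"
    proof (rule Weierstrass_m_test')
      fix n q assume q: "q \<in> cball x d"
      have 1: "norm q < 1" using nq[OF q] d by simp
      have "norm (q ^ a * (q ^ m) ^ n) = norm q ^ a * norm q ^ (m * n)"
        by (simp add: norm_mult norm_power power_mult)
      \<comment> \<open>\<open>norm q ^ a\<close> is at most 1, and \<open>m * n\<close> is at least
        \<open>n\<close> because \<open>m > 0\<close>.\<close>
      also have "\<dots> \<le> 1 * norm q ^ n"
        by (intro mult_mono power_le_one power_decreasing) (use 1 assms in auto)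
      also have "\<dots> \<le> (norm x + d) ^ n"
        using nq[OF q] by (simp add: power_mono)
      finally show "norm (norm (1 - q ^ a * (q ^ m) ^ n - 1)) \<le> (norm x + d) ^ n" by simp
    qed (use d in \<open>auto intro!: summable_geometric\<close>)
  qed (auto intro!: continuous_intros)
  then obtain g where g: "uniform_limit (cball x d) ?P g sequentially"
    by (auto simp: uniformly_convergent_on_def)
  have "g q = qpochhammer_inf (q ^ a) (q ^ m)" if "q \<in> cball x d" for q
  proof (rule LIMSEQ_unique)
    show "(\<lambda>n. ?P n q) \<longlonglongrightarrow> g q" by (rule tendsto_uniform_limitI[OF g that])
    have "norm (q ^ m) < 1" using that sub assms by (auto simp: norm_power power_less_one_iff)
    then show "(\<lambda>n. ?P n q) \<longlonglongrightarrow> qpochhammer_inf (q ^ a) (q ^ m)"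
      by (rule qpochhammer_inf_LIMSEQ)
  qed
  then have "uniform_limit (cball x d) ?P (\<lambda>q. qpochhammer_inf (q ^ a) (q ^ m)) sequentially"
    using g by (metis (no_types, lifting) uniform_limit_cong')
  with d sub show "\<exists>d>0. cball x d \<subseteq> ball 0 1 \<and>
      uniform_limit (cball x d) ?P (\<lambda>q. qpochhammer_inf (q ^ a) (q ^ m)) sequentially"
    by blast
qed auto

section \<open>The Jacobi triple product\<close>

text \<open>The Gaussian binomial coefficient. For \<open>norm q < 1\<close> no factor of the
  denominator vanishes; the value 0 for \<open>k > n\<close> keeps the Pascal recurrence valid at
  \<open>k = n\<close>.\<close>

definition qbinomial :: "complex \<Rightarrow> nat \<Rightarrow> nat \<Rightarrow> complex" where
  "qbinomial q n k = (if k \<le> n then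
     (\<Prod>i<n. 1 - q ^ Suc i) / ((\<Prod>i<k. 1 - q ^ Suc i) * (\<Prod>i<n - k. 1 - q ^ Suc i)) else 0)"

lemma one_minus_power_nonzero:
  assumes "norm (q :: complex) < 1"
  shows "1 - q ^ Suc i \<noteq> 0"
proof
  assume "1 - q ^ Suc i = 0"
  then have "norm q ^ Suc i = 1" by (metis norm_one norm_power right_minus_eq)
  then show False using assms power_less_one_iff[of "norm q" "Suc i"] by simp
qed

lemma qbinomial_0_right: "norm q < 1 \<Longrightarrow> qbinomial q n 0 = 1"
  using one_minus_power_nonzero by (simp add: qbinomial_def del: power_Suc)

text \<open>Rests on 1 - q^(n+1) = (1 - q^(k+1)) + q^(k+1) (1 - q^(n-k)).\<close>

lemma qbinomial_Suc_Suc: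
  assumes "norm q < 1"
  shows "qbinomial q (Suc n) (Suc k) = qbinomial q n k + q ^ Suc k * qbinomial q n (Suc k)"
proof -
  note nz = one_minus_power_nonzero[OF assms]
  define p where "p n = (\<Prod>i<n. 1 - q ^ Suc i)" for n
  have pSuc: "p (Suc n) = p n * (1 - q ^ Suc n)" for n by (simp add: p_def)
  have pnz: "p n \<noteq> 0" for n unfolding p_def using nz by (simp del: power_Suc)
  consider "k < n" | "k = n" | "k > n" by linarith
  then show ?thesis
  proof cases
    case 1
    define m where "m = n - Suc k"
    have n: "n = Suc k + m" using 1 by (simp add: m_def)
    have [simp]: "n - k = Suc m" "Suc n - Suc k = Suc m" "n - Suc k = m" "k \<le> n" "Suc k \<le> n"
      using 1 by (auto simp: m_def)
    have e: "1 - q ^ Suc n = (1 - q ^ Suc k) + q ^ Suc k * (1 - q ^ Suc m)"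
      by (simp add: n power_add algebra_simps)
    have "qbinomial q (Suc n) (Suc k) = p n * (1 - q ^ Suc n) / (p k * (1 - q ^ Suc k) * (p m * (1 - q ^ Suc m)))"
      by (simp add: qbinomial_def p_def[symmetric] pSuc del: power_Suc)
    also have "\<dots> = p n / (p k * (p m * (1 - q ^ Suc m))) + q ^ Suc k * (p n / (p k * (1 - q ^ Suc k) * p m))"
    proof -
      have "P * (a + b * c) / (A * a * (B * c)) = P / (A * (B * c)) + b * (P / (A * a * B))"
        if "A \<noteq> 0" "B \<noteq> 0" "a \<noteq> 0" "c \<noteq> 0" for P A B a b c :: complex
        using that by (simp add: field_simps)
      then show ?thesis unfolding e using pnz nz by blast
    qed
    also have "\<dots> = qbinomial q n k + q ^ Suc k * qbinomial q n (Suc k)"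
      by (simp add: qbinomial_def p_def[symmetric] pSuc del: power_Suc)
    finally show ?thesis .
  next
    case 2
    then show ?thesis using pnz by (simp add: qbinomial_def p_def[symmetric] del: power_Suc prod.lessThan_Suc)
  next
    case 3
    then show ?thesis by (simp add: qbinomial_def)
  qed
qed

lemma Suc_choose_two: "Suc k * (Suc k - 1) div 2 = k * (k - 1) div 2 + k"
proof -
  have "even (k * (k - 1))" by (cases k) auto
  moreover have "Suc k * (Suc k - 1) = k * (k - 1) + 2 * k"
    by (cases k) (auto simp: algebra_simps)
  ultimately show ?thesis by simp
qed

lemma int_choose_two: "int (k * (k - 1) div 2) = int k * (int k - 1) div 2"
  by (cases k) (simp_all add: zdiv_int algebra_simps)

text \<open>Peeling off the factor with \<open>k = 0\<close> leaves the same product at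
  \<open>x * q\<close>, hence the induction for arbitrary \<open>x\<close>; the recurrence then
  matches coefficients.\<close>

lemma qbinomial_theorem:
  assumes "norm q < 1"
  shows "(\<Prod>k<n. 1 + x * q ^ k) = (\<Sum>k\<le>n. q ^ (k * (k - 1) div 2) * qbinomial q n k * x ^ k)"
proof (induction n arbitrary: x)
  case 0
  show ?case by (simp add: qbinomial_def)
next
  case (Suc n)
  define c where "c k = q ^ (k * (k - 1) div 2)" for k :: nat
  have c: "c (Suc k) = c k * q ^ k" for k
    unfolding c_def Suc_choose_two power_add ..
  let ?b = "qbinomial q n"
  have b0: "?b (Suc n) = 0" by (simp add: qbinomial_def)
  have "(\<Prod>k<Suc n. 1 + x * q ^ k) = (1 + x) * (\<Prod>k<n. 1 + x * q * q ^ k)"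
    by (subst prod.lessThan_Suc_shift) (simp add: mult_ac)
  also have "\<dots> = (1 + x) * (\<Sum>k\<le>n. c k * q ^ k * ?b k * x ^ k)"
    unfolding Suc.IH c_def power_mult_distrib by (simp add: mult_ac)
  also have "\<dots> = (\<Sum>k\<le>Suc n. c k * q ^ k * ?b k * x ^ k) + (\<Sum>k\<le>n. c k * q ^ k * ?b k * x ^ Suc k)"
    by (simp add: b0 algebra_simps sum_distrib_left sum.distrib[symmetric])
  also have "\<dots> = ?b 0 + (\<Sum>k\<le>n. c (Suc k) * q ^ Suc k * ?b (Suc k) * x ^ Suc k + c k * q ^ k * ?b k * x ^ Suc k)"
    by (subst sum.atMost_Suc_shift) (simp add: sum.distrib c_def)
  also have "\<dots> = qbinomial q (Suc n) 0 + (\<Sum>k\<le>n. c (Suc k) * qbinomial q (Suc n) (Suc k) * x ^ Suc k)"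
    unfolding qbinomial_0_right[OF assms] qbinomial_Suc_Suc[OF assms] c
    by (simp add: algebra_simps)
  also have "\<dots> = (\<Sum>k\<le>Suc n. c k * qbinomial q (Suc n) k * x ^ k)"
    by (subst sum.atMost_Suc_shift) (simp add: c_def)
  finally show ?case by (simp add: c_def)
qed

section \<open>The bilateral theta series and the finite triple product\<close>

definition jacobi_term :: "complex \<Rightarrow> complex \<Rightarrow> int \<Rightarrow> complex" where
  "jacobi_term z q j = (- z) powi j * q powi (j * (j - 1) div 2)"

lemma powi_choose_two_sub:
  fixes q :: complex
  assumes "q \<noteq> 0"
  shows "q powi ((int k - int n) * (int k - int n - 1) div 2)
       = q powi ((- int n) * (- int n - 1) div 2) * q ^ (k * (k - 1) div 2) / (q ^ n) ^ k"
proof -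
  have two: "2 * (i * (i - 1) div 2) = i * (i - 1)" for i :: int by simp
  \<comment> \<open>With C(i) = i (i - 1) / 2 this is C(k - n) + n k = C(-n) + C(k), doubled so that
    every \<open>div\<close> disappears.\<close>
  have "2 * ((int k - int n) * (int k - int n - 1) div 2 + int n * int k)
      = 2 * ((- int n) * (- int n - 1) div 2 + int k * (int k - 1) div 2)"
    unfolding distrib_left two by (simp add: algebra_simps)
  then have "(int k - int n) * (int k - int n - 1) div 2 + int n * int k
      = (- int n) * (- int n - 1) div 2 + int (k * (k - 1) div 2)"
    unfolding int_choose_two by (simp only: mult_cancel_left) simp
  then have "q powi ((int k - int n) * (int k - int n - 1) div 2) * q powi (int n * int k)
      = q powi ((- int n) * (- int n - 1) div 2) * q powi int (k * (k - 1) div 2)"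
    by (metis assms power_int_add)
  moreover have "q powi (int n * int k) = (q ^ n) ^ k"
    by (metis of_nat_mult power_int_of_nat power_mult)
  ultimately show ?thesis using assms by (simp add: field_simps)
qed

lemma jacobi_term_shift:
  assumes "z \<noteq> 0" "q \<noteq> 0"
  shows "jacobi_term z q (int k - int n)
       = jacobi_term z q (- int n) * (q ^ (k * (k - 1) div 2) * (- z / q ^ n) ^ k)"
  unfolding jacobi_term_def powi_choose_two_sub[OF assms(2)] power_divide
  using assms by (simp add: power_int_diff power_int_minus field_simps)

text \<open>Evaluates the constant that is pulled out when the lower half of the product is reversed
  in the finite triple product.\<close>

lemma jacobi_term_minus_prod:
  assumes "z \<noteq> 0" "q \<noteq> 0"
  shows "jacobi_term z q (- int n) * (\<Prod>k<n. - z / q ^ Suc k) = 1"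
proof (induction n)
  case 0
  then show ?case by (simp add: jacobi_term_def)
next
  case (Suc n)
  have *: "jacobi_term z q (- int n) = jacobi_term z q (- int (Suc n)) * (- z / q ^ Suc n)"
    using jacobi_term_shift[OF assms, of 1 "Suc n"] by simp
  show ?case using Suc.IH unfolding * by (simp add: mult_ac)
qed

text \<open>Take \<open>2 * n\<close> factors of the q-binomial theorem at
  \<open>x = - z / q ^ n\<close>. The upper half is the product in \<open>z\<close>; the lower half,
  in reversed order, is the product in \<open>q / z\<close> up to a constant.\<close>

lemma finite_jacobi_triple_product:
  assumes q: "norm q < 1" "q \<noteq> 0" and z: "z \<noteq> 0"
  shows "(\<Prod>k<n. 1 - z * q ^ k) * (\<Prod>k<n. 1 - q / z * q ^ k)
       = (\<Sum>j\<in>{- int n..int n}. qbinomial q (2 * n) (nat (int n + j)) * jacobi_term z q j)"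
proof -
  define x where "x = - z / q ^ n"
  have "(\<Prod>k<2 * n. 1 + x * q ^ k) = (\<Prod>k<n. 1 + x * q ^ k) * (\<Prod>k<n. 1 - z * q ^ k)"
    using q by (simp add: mult_2 prod_lessThan_add x_def power_add)
  also have "(\<Prod>k<n. 1 + x * q ^ k) = (\<Prod>k<n. 1 + x * q ^ (n - Suc k))"
    by (rule prod.nat_diff_reindex[symmetric])
  also have "\<dots> = (\<Prod>k<n. (- z / q ^ Suc k) * (1 - q / z * q ^ k))"
  proof (rule prod.cong[OF refl])
    fix k assume "k \<in> {..<n}"
    then have "q ^ n = q ^ (n - Suc k) * q ^ Suc k"
      by (metis Suc_leI le_add_diff_inverse2 lessThan_iff power_add)
    then show "1 + x * q ^ (n - Suc k) = (- z / q ^ Suc k) * (1 - q / z * q ^ k)"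
      using q z by (simp add: x_def field_simps)
  qed
  also have "\<dots> = (\<Prod>k<n. - z / q ^ Suc k) * (\<Prod>k<n. 1 - q / z * q ^ k)"
    by (rule prod.distrib)
  finally have "(\<Prod>k<n. 1 - z * q ^ k) * (\<Prod>k<n. 1 - q / z * q ^ k)
      = jacobi_term z q (- int n) * (\<Prod>k<2 * n. 1 + x * q ^ k)"
    using jacobi_term_minus_prod[OF z q(2), of n] by (simp add: mult_ac)
  also have "\<dots> = (\<Sum>k\<le>2 * n. qbinomial q (2 * n) k * jacobi_term z q (int k - int n))"
    unfolding qbinomial_theorem[OF q(1)] sum_distrib_left jacobi_term_shift[OF z q(2)] x_def
    by (simp add: mult_ac)
  also have "\<dots> = (\<Sum>j\<in>{- int n..int n}. qbinomial q (2 * n) (nat (int n + j)) * jacobi_term z q j)"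
    by (rule sum.reindex_bij_witness[of _ "\<lambda>j. nat (int n + j)" "\<lambda>k. int k - int n"]) auto
  finally show ?thesis .
qed

text \<open>Supplies a majorant independent of \<open>n\<close> and \<open>k\<close>: the partial
  products of \<open>qpochhammer_inf q q\<close> converge to a nonzero limit, so they and their
  reciprocals are bounded.\<close>

lemma qbinomial_bounded:
  assumes "norm q < 1"
  obtains C where "\<And>n k. norm (qbinomial q n k) \<le> C"
proof -
  define p where "p n = (\<Prod>i<n. 1 - q ^ Suc i)" for n
  have p: "p \<longlonglongrightarrow> qpochhammer_inf q q"
    using qpochhammer_inf_LIMSEQ[OF assms, of q] by (simp add: p_def[abs_def])
  have nz: "qpochhammer_inf q q \<noteq> 0" by (rule qpochhammer_inf_nonzero'[OF assms assms])
  obtain A where A: "A > 0" "\<And>n. norm (p n) \<le> A"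
    using convergent_imp_Bseq[OF convergentI[OF p]] by (meson BseqE)
  obtain B where B: "B > 0" "\<And>n. norm (inverse (p n)) \<le> B"
    using convergent_imp_Bseq[OF convergentI[OF tendsto_inverse[OF p nz]]] by (meson BseqE)
  have "norm (qbinomial q n k) \<le> A * (B * B)" for n k
  proof (cases "k \<le> n")
    case True
    have "qbinomial q n k = p n * (inverse (p k) * inverse (p (n - k)))"
      using True by (simp add: qbinomial_def p_def divide_inverse)
    then show ?thesis
      unfolding norm_mult using A B by (simp add: norm_mult mult_mono less_imp_le)
  next
    case False
    then show ?thesis using A B by (simp add: qbinomial_def)
  qed
  then show thesis by (rule that)
qed

lemma qbinomial_central_LIMSEQ:
  assumes "norm q < 1"
  shows "(\<lambda>n. qbinomial q (2 * n) (nat (int n + j))) \<longlonglongrightarrow> 1 / qpochhammer_inf q q"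
proof -
  define p where "p n = (\<Prod>i<n. 1 - q ^ Suc i)" for n
  have p: "p \<longlonglongrightarrow> qpochhammer_inf q q"
    using qpochhammer_inf_LIMSEQ[OF assms, of q] by (simp add: p_def[abs_def])
  have nz: "qpochhammer_inf q q \<noteq> 0" by (rule qpochhammer_inf_nonzero'[OF assms assms])
  have lim: "filterlim (\<lambda>n. nat (int n + i)) at_top at_top" for i
    unfolding filterlim_at_top eventually_sequentially
  proof
    fix Z show "\<exists>N. \<forall>n\<ge>N. Z \<le> nat (int n + i)"
      by (rule exI[of _ "nat (int Z - i)"]) auto
  qed
  have lim2: "filterlim (\<lambda>n::nat. 2 * n) at_top at_top"
    by (rule filterlim_subseq) (auto intro: strict_monoI)
  have "(\<lambda>n. p (2 * n) / (p (nat (int n + j)) * p (nat (int n + - j))))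
      \<longlonglongrightarrow> qpochhammer_inf q q / (qpochhammer_inf q q * qpochhammer_inf q q)"
    using nz by (intro tendsto_intros filterlim_compose[OF p] lim lim2) auto
  moreover have "eventually (\<lambda>n. p (2 * n) / (p (nat (int n + j)) * p (nat (int n + - j)))
      = qbinomial q (2 * n) (nat (int n + j))) at_top"
    using eventually_ge_at_top[of "nat \<bar>j\<bar>"]
  proof eventually_elim
    case (elim n)
    then have "2 * n - nat (int n + j) = nat (int n + - j)" "nat (int n + j) \<le> 2 * n" by auto
    then show ?case by (simp add: qbinomial_def p_def)
  qed
  ultimately show ?thesis using nz by (simp add: tendsto_cong)
qed

lemma summable_theta_nat:
  fixes x p :: real
  assumes "0 < x" "0 < p" "p < 1"
  shows "summable (\<lambda>n. x ^ n * p ^ (n * (n - 1) div 2))"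
proof -
  have "(\<lambda>n. x * p ^ n) \<longlonglongrightarrow> x * 0"
    by (intro tendsto_intros LIMSEQ_power_zero) (use assms in auto)
  then have "eventually (\<lambda>n. x * p ^ n < 1 / 2) sequentially"
    by (rule order_tendstoD) simp
  then obtain N where N: "\<And>n. n \<ge> N \<Longrightarrow> x * p ^ n < 1 / 2"
    by (auto simp: eventually_sequentially)
  show ?thesis
  proof (rule summable_ratio_test)
    fix n assume n: "n \<ge> N"
    have "norm (x ^ Suc n * p ^ (Suc n * (Suc n - 1) div 2)) = (x * p ^ n) * (x ^ n * p ^ (n * (n - 1) div 2))"
      unfolding Suc_choose_two power_add using assms by simp
    also have "\<dots> \<le> 1 / 2 * (x ^ n * p ^ (n * (n - 1) div 2))"
      by (rule mult_right_mono) (use N[OF n] assms in auto)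
    finally show "norm (x ^ Suc n * p ^ (Suc n * (Suc n - 1) div 2)) \<le> 1 / 2 * norm (x ^ n * p ^ (n * (n - 1) div 2))"
      using assms by simp
  qed simp
qed

lemma jacobi_term_abs_summable:
  assumes q: "norm q < 1" "q \<noteq> 0" and z: "z \<noteq> 0"
  shows "(\<lambda>j. norm (jacobi_term z q j)) summable_on UNIV"
proof -
  have *: "(\<lambda>n. norm (jacobi_term z q (int n))) summable_on UNIV"
  proof -
    have "norm (jacobi_term z q (int n)) = norm z ^ n * norm q ^ (n * (n - 1) div 2)" for n
    proof -
      show ?thesis unfolding jacobi_term_def int_choose_two[symmetric]
        by (simp add: norm_mult norm_power)
    qed
    moreover have "summable (\<lambda>n. norm z ^ n * norm q ^ (n * (n - 1) div 2))"
      by (rule summable_theta_nat) (use q z in auto)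
    ultimately show ?thesis
      by (subst summable_on_UNIV_nonneg_real_iff) auto
  qed
  have **: "(\<lambda>n. norm (jacobi_term z q (- int n))) summable_on UNIV"
  proof -
    have "norm (jacobi_term z q (- int n)) = norm (q / z) ^ n * norm q ^ (n * (n - 1) div 2)" for n
    proof -
      \<comment> \<open>This makes the negative half of the series the positive half with
        \<open>q / z\<close> in place of \<open>z\<close>.\<close>
      have "(- int n) * (- int n - 1) div 2 = int (n * (n - 1) div 2) + int n"
      proof -
        have "even (int n * (int n - 1))" by simp
        moreover have "(- int n) * (- int n - 1) = int n * (int n - 1) + 2 * int n"
          by (simp add: algebra_simps)
        ultimately show ?thesis unfolding int_choose_two by simp
      qed
      then show ?thesis using q z
        by (simp add: jacobi_term_def norm_mult norm_power norm_power_int power_int_add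
            power_int_minus norm_divide power_divide field_simps)
    qed
    moreover have "summable (\<lambda>n. norm (q / z) ^ n * norm q ^ (n * (n - 1) div 2))"
      by (rule summable_theta_nat) (use q z in auto)
    ultimately show ?thesis
      by (subst summable_on_UNIV_nonneg_real_iff) auto
  qed
  \<comment> \<open>Index 0 lies in both ranges, which is harmless since only summability over the
    union is claimed.\<close>
  have "(\<lambda>j. norm (jacobi_term z q j)) summable_on range int"
    using * by (subst summable_on_reindex) (auto simp: o_def)
  moreover have "(\<lambda>j. norm (jacobi_term z q j)) summable_on range (\<lambda>n. - int n)"
    using ** by (subst summable_on_reindex) (auto simp: o_def inj_on_def)
  ultimately have "(\<lambda>j. norm (jacobi_term z q j)) summable_on (range int \<union> range (\<lambda>n. - int n))"
    by (rule summable_on_union)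
  moreover have "range int \<union> range (\<lambda>n. - int n) = UNIV"
  proof -
    have "j \<in> range int \<union> range (\<lambda>n. - int n)" for j
      by (cases j rule: int_cases2) auto
    then show ?thesis by blast
  qed
  ultimately show ?thesis by simp
qed

text \<open>In the finite form the coefficients stay bounded and tend to
  \<open>1 / qpochhammer_inf q q\<close>, so dominated convergence for the counting measure on the
  integers exchanges limit and sum.\<close>

theorem jacobi_triple_product:
  assumes q: "norm q < 1" "q \<noteq> 0" and z: "z \<noteq> 0"
  shows "(jacobi_term z q has_sum
           (qpochhammer_inf z q * qpochhammer_inf (q / z) q * qpochhammer_inf q q)) UNIV"
proof -
  let ?M = "count_space (UNIV :: int set)"
  let ?E = "qpochhammer_inf q q"
  obtain C where C: "\<And>n k. norm (qbinomial q n k) \<le> C"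
    using qbinomial_bounded[OF q(1)] by blast
  \<comment> \<open>Extension by 0 turns the finite sums into integrals over one fixed
    space.\<close>
  define f where "f n j = (if j \<in> {- int n..int n} then qbinomial q (2 * n) (nat (int n + j)) * jacobi_term z q j else 0)" for n j
  have nz: "?E \<noteq> 0" by (rule qpochhammer_inf_nonzero'[OF q(1) q(1)])
  have summ: "Infinite_Set_Sum.abs_summable_on (jacobi_term z q) UNIV"
    using jacobi_term_abs_summable[OF assms] by (simp add: abs_summable_equivalent)
  have w: "integrable ?M (\<lambda>j. C * norm (jacobi_term z q j))"
    using summ by (auto simp: Infinite_Set_Sum.abs_summable_on_def)
  have lim: "(\<lambda>n. f n j) \<longlonglongrightarrow> 1 / ?E * jacobi_term z q j" for j
  proof -
    have "(\<lambda>n. qbinomial q (2 * n) (nat (int n + j)) * jacobi_term z q j) \<longlonglongrightarrow> 1 / ?E * jacobi_term z q j"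
      by (intro tendsto_intros qbinomial_central_LIMSEQ q)
    moreover have "eventually (\<lambda>n. qbinomial q (2 * n) (nat (int n + j)) * jacobi_term z q j = f n j) at_top"
      using eventually_ge_at_top[of "nat \<bar>j\<bar>"] by eventually_elim (auto simp: f_def)
    ultimately show ?thesis by (rule Lim_transform_eventually)
  qed
  have C0: "C \<ge> 0" using C[of 0 0] norm_ge_zero order_trans by blast
  have bound: "norm (f n j) \<le> C * norm (jacobi_term z q j)" for n j
    using C C0 by (auto simp: f_def norm_mult intro!: mult_right_mono)
  have "(\<lambda>n. integral\<^sup>L ?M (f n)) \<longlonglongrightarrow> integral\<^sup>L ?M (\<lambda>j. 1 / ?E * jacobi_term z q j)"
    by (rule integral_dominated_convergence[OF _ _ w]) (use lim bound in auto)
  moreover have "integral\<^sup>L ?M (f n) = (\<Prod>k<n. 1 - z * q ^ k) * (\<Prod>k<n. 1 - q / z * q ^ k)" for n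
  proof -
    have "integral\<^sup>L ?M (f n) = (\<Sum>j | j \<in> UNIV \<and> f n j \<noteq> 0. f n j)"
      by (rule lebesgue_integral_count_space_finite_support)
         (auto intro: finite_subset[of _ "{- int n..int n}"] simp: f_def)
    also have "\<dots> = (\<Sum>j\<in>{- int n..int n}. f n j)"
      by (rule sum.mono_neutral_left) (auto simp: f_def)
    finally show ?thesis unfolding finite_jacobi_triple_product[OF assms] by (simp add: f_def)
  qed
  moreover have "(\<lambda>n. (\<Prod>k<n. 1 - z * q ^ k) * (\<Prod>k<n. 1 - q / z * q ^ k))
      \<longlonglongrightarrow> qpochhammer_inf z q * qpochhammer_inf (q / z) q"
    by (intro tendsto_intros qpochhammer_inf_LIMSEQ q)
  ultimately have "integral\<^sup>L ?M (\<lambda>j. 1 / ?E * jacobi_term z q j) = qpochhammer_inf z q * qpochhammer_inf (q / z) q"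
    using LIMSEQ_unique by simp
  then have "infsetsum (jacobi_term z q) UNIV = qpochhammer_inf z q * qpochhammer_inf (q / z) q * ?E"
    using nz by (simp add: infsetsum_def field_simps)
  moreover have "jacobi_term z q summable_on UNIV"
    using jacobi_term_abs_summable[OF assms] by (rule abs_summable_summable)
  ultimately show ?thesis
    using infsetsum_infsum[OF summ] by (simp add: has_sum_iff)
qed

section \<open>Weierstrass' three-term identity\<close>

definition jtheta :: "complex \<Rightarrow> complex \<Rightarrow> complex" where
  "jtheta z q = qpochhammer_inf z q * qpochhammer_inf (q / z) q"

lemma jtheta_has_sum:
  assumes "norm q < 1" "q \<noteq> 0" "z \<noteq> 0"
  shows "(jacobi_term z q has_sum (jtheta z q * qpochhammer_inf q q)) UNIV"
  using jacobi_triple_product[OF assms] by (simp add: jtheta_def)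

lemma jtheta_reflect: "q \<noteq> 0 \<Longrightarrow> z \<noteq> 0 \<Longrightarrow> jtheta (q / z) q = jtheta z q"
  by (simp add: jtheta_def mult.commute)

lemma jtheta_1 [simp]: "norm q < 1 \<Longrightarrow> jtheta 1 q = 0"
  using qpochhammer_inf_rec[of q 1] by (simp add: jtheta_def)

text \<open>One product loses the factor 1 - z and the other gains 1 - 1/z = -(1 - z)/z.\<close>

lemma jtheta_shift:
  assumes "norm q < 1" "q \<noteq> 0" "z \<noteq> 0"
  shows "jtheta (q * z) q = - jtheta z q / z"
proof -
  have a: "jtheta (q * z) q = qpochhammer_inf (q * z) q * ((1 - 1 / z) * qpochhammer_inf (q / z) q)"
    using qpochhammer_inf_rec[OF assms(1), of "1 / z"] assms by (simp add: jtheta_def)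
  have b: "jtheta z q = (1 - z) * qpochhammer_inf (q * z) q * qpochhammer_inf (q / z) q"
    using qpochhammer_inf_rec[OF assms(1), of z] by (simp add: jtheta_def mult.commute)
  show ?thesis
    unfolding a b using assms by (simp add: field_simps)
qed

lemma jtheta_inverse:
  assumes "norm q < 1" "q \<noteq> 0" "z \<noteq> 0"
  shows "jtheta (1 / z) q = - jtheta z q / z"
  using jtheta_shift[OF assms] jtheta_reflect[of q "1 / z"] assms by simp

lemma jtheta_split:
  assumes "norm q < 1" "q \<noteq> 0" "z \<noteq> 0"
  shows "jtheta z q = jtheta z (q ^ 2) * jtheta (z * q) (q ^ 2)"
  using assms qpochhammer_inf_split[OF assms(1), of 2]
  by (simp add: jtheta_def eval_nat_numeral mult_ac)

lemma jtheta_nonzero: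
  assumes "norm q < 1" "norm z < 1" "norm q < norm z"
  shows "jtheta z q \<noteq> 0"
proof -
  have "norm (q / z) < 1"
    using assms by (auto simp: norm_divide divide_simps)
  then show ?thesis
    using assms by (simp add: jtheta_def qpochhammer_inf_nonzero')
qed

section \<open>Products of theta series and the addition formula\<close>

lemma has_sum_product:
  fixes f g :: "'a \<Rightarrow> complex"
  assumes "(f has_sum a) A" "(g has_sum b) B"
  shows "((\<lambda>(i, j). f i * g j) has_sum a * b) (A \<times> B)"
proof (rule has_sum_SigmaI)
  show "((\<lambda>j. (\<lambda>(i, j). f i * g j) (i, j)) has_sum f i * b) B" for i
    using has_sum_cmult_right[OF assms(2), of "f i"] by simp
  show "((\<lambda>i. f i * b) has_sum a * b) A"
    by (rule has_sum_cmult_left[OF assms(1)])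
  \<comment> \<open>Summable complex families are absolutely summable, which is what makes the
    double series summable.\<close>
  have f: "(\<lambda>i. norm (f i)) summable_on A" and g: "(\<lambda>i. norm (g i)) summable_on B"
    using assms by (auto simp: has_sum_imp_summable summable_on_iff_abs_summable_on_complex[symmetric])
  have "(\<lambda>(i, j). norm (f i) * norm (g j)) summable_on A \<times> B"
  proof (rule summable_on_SigmaI)
    show "((\<lambda>j. (\<lambda>(i, j). norm (f i) * norm (g j)) (i, j)) has_sum
        norm (f i) * infsum (\<lambda>j. norm (g j)) B) B" for i
      using has_sum_cmult_right[OF has_sum_infsum[OF g], of "norm (f i)"] by simp
    show "(\<lambda>i. norm (f i) * infsum (\<lambda>j. norm (g j)) B) summable_on A"
      using f by (rule summable_on_cmult_left)
  qed auto
  then have "(\<lambda>x. norm ((\<lambda>(i, j). f i * g j) x)) summable_on A \<times> B"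
    by (simp add: norm_mult case_prod_unfold)
  then show "(\<lambda>(i, j). f i * g j) summable_on A \<times> B"
    by (rule abs_summable_summable)
qed

text \<open>Jacobi's theta_3 with nome \<open>q\<close> and \<open>x\<close> = exp(i z), in product
  form; \<open>theta_odd\<close> is theta_2 without its factor q^(1/4).\<close>

definition theta_even :: "complex \<Rightarrow> complex \<Rightarrow> complex" where
  "theta_even q x = jtheta (- (x ^ 2 * q)) (q ^ 2) * qpochhammer_inf (q ^ 2) (q ^ 2)"

definition theta_odd :: "complex \<Rightarrow> complex \<Rightarrow> complex" where
  "theta_odd q x = x * (jtheta (- (x ^ 2 * q ^ 2)) (q ^ 2) * qpochhammer_inf (q ^ 2) (q ^ 2))"

lemma theta_even_has_sum:
  assumes "norm q < 1" "q \<noteq> 0" "x \<noteq> 0"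
  shows "((\<lambda>n::int. x powi (2 * n) * q powi (n * n)) has_sum theta_even q x) UNIV"
proof -
  have "(x ^ 2 * q) powi n * (q ^ 2) powi (n * (n - 1) div 2) = x powi (2 * n) * q powi (n * n)" for n :: int
  proof -
    have "q powi n * q powi (n * (n - 1)) = q powi (n * n)"
      using assms by (subst power_int_add[symmetric]) (auto simp: algebra_simps)
    then show ?thesis
      by (simp add: power_int_mult_distrib power_int_power mult_ac)
  qed
  then show ?thesis
    using jtheta_has_sum[of "q ^ 2" "- (x ^ 2 * q)"] assms
    by (simp add: theta_even_def jacobi_term_def[abs_def] norm_power power_less_one_iff)
qed

lemma theta_odd_has_sum:
  assumes "norm q < 1" "q \<noteq> 0" "x \<noteq> 0"
  shows "((\<lambda>n::int. x powi (2 * n + 1) * q powi (n * n + n)) has_sum theta_odd q x) UNIV"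
proof -
  have "x * ((x ^ 2 * q ^ 2) powi n * (q ^ 2) powi (n * (n - 1) div 2)) = x powi (2 * n + 1) * q powi (n * n + n)" for n :: int
  proof -
    have "q powi (2 * n) * q powi (n * (n - 1)) = q powi (n * n + n)"
      using assms by (subst power_int_add[symmetric]) (auto simp: algebra_simps)
    then show ?thesis using assms
      by (simp add: power_int_mult_distrib power_int_power power_int_add_1' mult_ac)
  qed
  then show ?thesis
    using has_sum_cmult_right[OF jtheta_has_sum[of "q ^ 2" "- (x ^ 2 * q ^ 2)"], of x] assms
    by (simp add: theta_odd_def jacobi_term_def[abs_def] norm_power power_less_one_iff)
qed

lemma jacobi_term_product:
  assumes "x \<noteq> 0" "y \<noteq> 0" "q \<noteq> 0"
  shows "jacobi_term (x * y) q m * jacobi_term (x / y) q n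
       = (- 1) powi (m + n) * x powi (m + n) * y powi (m - n)
         * q powi (m * (m - 1) div 2 + n * (n - 1) div 2)"
proof -
  have "(- (x * y)) powi m = (- 1) powi m * x powi m * y powi m"
    by (simp add: power_int_mult_distrib power_int_minus_left mult_ac)
  moreover have "(- (x / y)) powi n = (- 1) powi n * x powi n / y powi n"
    by (simp add: power_int_divide_distrib power_int_minus_left mult_ac)
  ultimately show ?thesis using assms
    by (simp add: jacobi_term_def power_int_add power_int_diff field_simps)
qed

text \<open>Splitting the double series for the left-hand side by the parity of \<open>m + n\<close>.\<close>

lemma jtheta_addition:
  assumes q: "norm q < 1" "q \<noteq> 0" and nz: "x \<noteq> 0" "y \<noteq> 0"
  shows "jtheta (x * y) q * jtheta (x / y) q * qpochhammer_inf q q ^ 2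
       = x * (theta_odd q x * theta_even q y - theta_even q x * theta_odd q y)"
proof -
  define f where "f = (\<lambda>(m, n). jacobi_term (x * y) q m * jacobi_term (x / y) q n)"
  define E where "E = {p :: int \<times> int. even (fst p + snd p)}"
  have two: "2 * (i * (i - 1) div 2) = i * (i - 1)" for i :: int by simp
  have "(f has_sum (jtheta (x * y) q * qpochhammer_inf q q) * (jtheta (x / y) q * qpochhammer_inf q q)) (UNIV \<times> UNIV)"
    unfolding f_def using q nz by (intro has_sum_product jtheta_has_sum) auto
  then have *: "(f has_sum jtheta (x * y) q * jtheta (x / y) q * qpochhammer_inf q q ^ 2) UNIV"
    by (simp add: power2_eq_square mult_ac)
  have even: "(f has_sum x * (theta_odd q x * theta_even q y)) E"
  proof -
    have "((\<lambda>(r, t). (x powi (2 * r + 1) * q powi (r * r + r)) * (y powi (2 * t) * q powi (t * t)))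
        has_sum theta_odd q x * theta_even q y) (UNIV \<times> UNIV)"
      using q nz by (intro has_sum_product theta_odd_has_sum theta_even_has_sum) auto
    from has_sum_cmult_right[OF this, of x]
    show ?thesis
    proof (rule has_sum_reindex_bij_witness[THEN iffD1, rotated -1])
      fix p :: "int \<times> int" assume "p \<in> UNIV \<times> UNIV"
      obtain r t where p: "p = (r, t)" by force
      \<comment> \<open>The pairs with even sum are \<open>m = r + 1 + t\<close>,
        \<open>n = r + 1 - t\<close>. The shift by 1 turns the exponent \<open>r * r - r\<close>
        into \<open>r * r + r\<close>, as in \<open>theta_odd\<close>.\<close>
      have "2 * ((r + 1 + t) * (r + 1 + t - 1) div 2 + (r + 1 - t) * (r + 1 - t - 1) div 2)
          = 2 * ((r * r + r) + t * t)"
        unfolding distrib_left two by (simp add: algebra_simps)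
      then have e: "(r + 1 + t) * (r + 1 + t - 1) div 2 + (r + 1 - t) * (r + 1 - t - 1) div 2
          = (r * r + r) + t * t" by (simp only: mult_cancel_left) simp
      have e1: "(r + 1 + t) + (r + 1 - t) = 2 * r + 1 + 1" "(r + 1 + t) - (r + 1 - t) = 2 * t" by auto
      show "f ((\<lambda>(r, t). (r + 1 + t, r + 1 - t)) p)
          = x * (case p of (r, t) \<Rightarrow> x powi (2 * r + 1) * q powi (r * r + r) * (y powi (2 * t) * q powi (t * t)))"
        unfolding p f_def prod.case jacobi_term_product[OF nz q(2)] e e1
        using nz q by (simp add: power_int_add power_int_minus_left power2_eq_square)
    next
      show "(\<lambda>(m, n). ((m + n) div 2 - 1, (m - n) div 2)) ((\<lambda>(r, t). (r + 1 + t, r + 1 - t)) p) = p"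
        for p :: "int \<times> int" by (cases p) auto
      show "(\<lambda>(r, t). (r + 1 + t, r + 1 - t)) p \<in> E" for p :: "int \<times> int"
        by (cases p) (auto simp: E_def)
      show "(\<lambda>(r, t). (r + 1 + t, r + 1 - t)) ((\<lambda>(m, n). ((m + n) div 2 - 1, (m - n) div 2)) p) = p"
        if "p \<in> E" for p :: "int \<times> int"
        using that by (cases p) (auto simp: E_def elim!: evenE, presburger+)
    qed auto
  qed
  have odd: "(f has_sum - x * (theta_even q x * theta_odd q y)) (- E)"
  proof -
    have "((\<lambda>(r, t). (x powi (2 * r) * q powi (r * r)) * (y powi (2 * t + 1) * q powi (t * t + t)))
        has_sum theta_even q x * theta_odd q y) (UNIV \<times> UNIV)"
      using q nz by (intro has_sum_product theta_odd_has_sum theta_even_has_sum) auto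
    from has_sum_cmult_right[OF this, of "- x"]
    show ?thesis
    proof (rule has_sum_reindex_bij_witness[THEN iffD1, rotated -1])
      fix p :: "int \<times> int" assume "p \<in> UNIV \<times> UNIV"
      obtain r t where p: "p = (r, t)" by force
      \<comment> \<open>The pairs with odd sum are \<open>m = r + t + 1\<close>,
        \<open>n = r - t\<close>; the sign \<open>(- 1) powi (m + n)\<close> is now -1.\<close>
      have "2 * ((r + t + 1) * (r + t + 1 - 1) div 2 + (r - t) * (r - t - 1) div 2)
          = 2 * (r * r + (t * t + t))"
        unfolding distrib_left two by (simp add: algebra_simps)
      then have e: "(r + t + 1) * (r + t + 1 - 1) div 2 + (r - t) * (r - t - 1) div 2
          = r * r + (t * t + t)" by (simp only: mult_cancel_left) simp
      have e1: "(r + t + 1) + (r - t) = 2 * r + 1" "(r + t + 1) - (r - t) = 2 * t + 1" by auto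
      show "f ((\<lambda>(r, t). (r + t + 1, r - t)) p)
          = - x * (case p of (r, t) \<Rightarrow> x powi (2 * r) * q powi (r * r) * (y powi (2 * t + 1) * q powi (t * t + t)))"
        unfolding p f_def prod.case jacobi_term_product[OF nz q(2)] e e1
        using nz q by (simp add: power_int_add power_int_minus_left power2_eq_square)
    next
      show "(\<lambda>(m, n). ((m + n) div 2, (m - n) div 2)) ((\<lambda>(r, t). (r + t + 1, r - t)) p) = p"
        for p :: "int \<times> int" by (cases p) auto
      show "(\<lambda>(r, t). (r + t + 1, r - t)) p \<in> - E" for p :: "int \<times> int"
        by (cases p) (auto simp: E_def)
      show "(\<lambda>(r, t). (r + t + 1, r - t)) ((\<lambda>(m, n). ((m + n) div 2, (m - n) div 2)) p) = p"
        if "p \<in> - E" for p :: "int \<times> int"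
      proof -
        obtain m n where p: "p = (m, n)" by force
        have "odd (m + n)" using that by (simp add: p E_def)
        then have "(m + n) div 2 + (m - n) div 2 + 1 = m" "(m + n) div 2 - (m - n) div 2 = n"
          by presburger+
        then show ?thesis by (simp add: p)
      qed
    qed auto
  qed
  have "(f has_sum x * (theta_odd q x * theta_even q y) + - x * (theta_even q x * theta_odd q y)) (E \<union> - E)"
    by (rule has_sum_Un_disjoint[OF even odd]) auto
  then have "(f has_sum x * (theta_odd q x * theta_even q y) + - x * (theta_even q x * theta_odd q y)) UNIV"
    by simp
  from has_sum_unique[OF * this] show ?thesis by (simp add: algebra_simps)
qed

text \<open>By the addition formula, \<open>jtheta (x * y) q * jtheta (x / y) q / x\<close> is an alternating form of
  rank two in \<open>x\<close> and \<open>y\<close>, so this is a Pluecker relation.\<close>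

theorem weierstrass_three_term:
  assumes q: "norm q < 1" "q \<noteq> 0" and nz: "x \<noteq> 0" "y \<noteq> 0" "u \<noteq> 0" "v \<noteq> 0"
  shows "v * y * (jtheta (x * y) q * jtheta (x / y) q * jtheta (u * v) q * jtheta (u / v) q)
       + u * y * (jtheta (x * u) q * jtheta (x / u) q * jtheta (v * y) q * jtheta (v / y) q)
       + u * v * (jtheta (x * v) q * jtheta (x / v) q * jtheta (y * u) q * jtheta (y / u) q) = 0"
    (is "?S = 0")
proof -
  define e where "e = qpochhammer_inf q q ^ 2"
  define F where "F x y = jtheta (x * y) q * jtheta (x / y) q" for x y
  define a b where "a = theta_even q" and "b = theta_odd q"
  have F: "F x y * e = x * (b x * a y - a x * b y)" if "x \<noteq> 0" "y \<noteq> 0" for x y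
    using jtheta_addition[OF q that] by (simp add: F_def e_def a_def b_def)
  \<comment> \<open>The weights \<open>v * y\<close>, \<open>u * y\<close>, \<open>u * v\<close>
    give every summand the same factor \<open>x * y * u * v\<close> once \<open>F\<close> is
    expanded.\<close>
  have "?S * e ^ 2 = v * y * ((F x y * e) * (F u v * e)) + u * y * ((F x u * e) * (F v y * e))
      + u * v * ((F x v * e) * (F y u * e))"
    by (simp add: F_def power2_eq_square algebra_simps)
  also have "\<dots> = 0"
    unfolding F[OF nz(1,2)] F[OF nz(3,4)] F[OF nz(1,3)] F[OF nz(4,2)] F[OF nz(1,4)] F[OF nz(2,3)]
    by (simp add: algebra_simps)
  finally show ?thesis
    using qpochhammer_inf_nonzero'[OF q(1) q(1)] by (simp add: e_def)
qed

section \<open>Modular equations of degree 2 and 4\<close>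

lemma jtheta_power_reflect:
  assumes "q \<noteq> 0" "j \<le> m"
  shows "jtheta (q ^ (m - j)) (q ^ m) = jtheta (q ^ j) (q ^ m)"
  using jtheta_reflect[of "q ^ m" "q ^ j"] assms by (simp add: power_diff)

lemma norm_power_less_one: "norm (q :: complex) < 1 \<Longrightarrow> 0 < m \<Longrightarrow> norm (q ^ m) < 1"
  by (simp add: norm_power power_less_one_iff)

lemma jtheta_power_inverse:
  assumes "norm q < 1" "q \<noteq> 0" "0 < m"
  shows "jtheta (1 / q ^ j) (q ^ m) = - jtheta (q ^ j) (q ^ m) / q ^ j"
  by (rule jtheta_inverse) (use assms norm_power_less_one in auto)

lemma jtheta_power_nonzero:
  assumes "norm q < 1" "q \<noteq> 0" "0 < j" "j < m"
  shows "jtheta (q ^ j) (q ^ m) \<noteq> 0"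
  by (rule jtheta_nonzero)
     (use assms norm_power_less_one in \<open>auto simp: norm_power intro!: power_strict_decreasing\<close>)

lemma jtheta_power_split:
  assumes "norm q < 1" "q \<noteq> 0" "0 < m"
  shows "jtheta (q ^ j) (q ^ m) = jtheta (q ^ j) (q ^ (2 * m)) * jtheta (q ^ (j + m)) (q ^ (2 * m))"
  using jtheta_split[of "q ^ m" "q ^ j"] assms norm_power_less_one[of q m]
  by (simp add: power_add power_mult mult.commute[of 2] del: power_mult_numeral)

lemma rogers_ramanujan_T_jtheta:
  assumes "q \<noteq> 0"
  shows "rogers_ramanujan_T q = jtheta q (q ^ 5) / jtheta (q ^ 2) (q ^ 5)"
proof -
  have "q ^ 5 / q = q ^ 4" "q ^ 5 / q ^ 2 = q ^ 3"
    using assms by (simp_all add: field_simps eval_nat_numeral)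
  then show ?thesis
    by (simp add: rogers_ramanujan_T_def rogers_ramanujan_G_def rogers_ramanujan_H_def jtheta_def)
qed

text \<open>Weierstrass' identity in base \<open>q ^ 10\<close> at powers of \<open>q\<close> with
  exponents 2, 0, 3, 4 and 1, 0, 2, 4; reflection brings all indices into the range 1 to 5. The two
  brackets will factor 1 - k and 1 + k for k = q t1 t2 / (t3 t4).\<close>

lemma theta_identities_10:
  assumes q: "norm q < 1" "q \<noteq> 0"
  defines "t \<equiv> \<lambda>j. jtheta (q ^ j) (q ^ 10)"
  shows "t 2 * t 3 * (t 3 * t 4 - q * t 1 * t 2) = t 1 * t 4 ^ 2 * t 5"
    and "t 1 * t 4 * (t 3 * t 4 + q * t 1 * t 2) = t 2 ^ 2 * t 3 * t 5"
proof -
  have refl: "t 6 = t 4" "t 7 = t 3"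
    unfolding t_def using jtheta_power_reflect[OF q(2), of 4 10] jtheta_power_reflect[OF q(2), of 3 10] by simp_all
  have inv: "jtheta (1 / q ^ j) (q ^ 10) = - t j / q ^ j" for j
    unfolding t_def by (rule jtheta_power_inverse) (use q in auto)
  have *: "q ^ i * q ^ j = q ^ (i + j)" "i \<ge> j \<Longrightarrow> q ^ i / q ^ j = q ^ (i - j)"
    "i < j \<Longrightarrow> q ^ i / q ^ j = 1 / q ^ (j - i)" for i j
    using q by (simp_all add: power_add power_diff)
  have **: "q * q ^ 2 = q ^ 3" "q * q ^ 4 = q ^ 5" "q / q ^ 2 = 1 / q" "q / q ^ 4 = 1 / q ^ 3"
    using q by (simp_all add: field_simps eval_nat_numeral)
  note W = weierstrass_three_term[of "q ^ 10" "q ^ a" "q ^ b" "q ^ c" "q ^ d" for a b c d]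
  have 1: "q ^ 4 * q ^ 0 * (t 2 * t 2 * t 7 * (- t 1 / q ^ 1))
      + q ^ 3 * q ^ 0 * (t 5 * (- t 1 / q ^ 1) * t 4 * t 4)
      + q ^ 3 * q ^ 4 * (t 6 * (- t 2 / q ^ 2) * t 3 * (- t 3 / q ^ 3)) = 0"
    using W[of 2 0 3 4] norm_power_less_one[OF q(1), of 10] q(2)
    unfolding inv[symmetric] unfolding t_def by (simp add: *)
  have "q ^ 2 * (t 2 * t 3 * (t 3 * t 4 - q * t 1 * t 2) - t 1 * t 4 ^ 2 * t 5) = 0"
    using 1 q(2) unfolding refl by (simp add: field_simps eval_nat_numeral)
  then show "t 2 * t 3 * (t 3 * t 4 - q * t 1 * t 2) = t 1 * t 4 ^ 2 * t 5"
    using q(2) by simp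
  have 2: "q ^ 4 * q ^ 0 * (t 1 * t 1 * t 6 * (- t 2 / q ^ 2))
      + q ^ 2 * q ^ 0 * (t 3 * (- t 1 / q ^ 1) * t 4 * t 4)
      + q ^ 2 * q ^ 4 * (t 5 * (- t 3 / q ^ 3) * t 2 * (- t 2 / q ^ 2)) = 0"
    using W[of 1 0 2 4] norm_power_less_one[OF q(1), of 10] q(2)
    unfolding inv[symmetric] unfolding t_def by (simp add: * **)
  have "q * (t 1 * t 4 * (t 3 * t 4 + q * t 1 * t 2) - t 2 ^ 2 * t 3 * t 5) = 0"
    using 2 q(2) unfolding refl by (simp add: field_simps eval_nat_numeral)
  then show "t 1 * t 4 * (t 3 * t 4 + q * t 1 * t 2) = t 2 ^ 2 * t 3 * t 5"
    using q(2) by simp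
qed

text \<open>Weierstrass' identity in base \<open>q ^ 20\<close> with exponents 8, 4, 5, 0; it is the
  source of the relation involving T(q^4).\<close>

lemma theta_identity_20:
  assumes q: "norm q < 1" "q \<noteq> 0"
  defines "t \<equiv> \<lambda>j. jtheta (q ^ j) (q ^ 20)"
  shows "t 4 * t 5 ^ 2 * t 8 = t 1 * t 8 ^ 2 * t 9 + q * t 3 * t 4 ^ 2 * t 7"
proof -
  have refl: "t 12 = t 8" "t 13 = t 7"
    unfolding t_def using jtheta_power_reflect[OF q(2), of 8 20] jtheta_power_reflect[OF q(2), of 7 20] by simp_all
  have inv: "jtheta (1 / q ^ j) (q ^ 20) = - t j / q ^ j" for j
    unfolding t_def by (rule jtheta_power_inverse) (use q in auto)
  have *: "q ^ i * q ^ j = q ^ (i + j)" "i \<ge> j \<Longrightarrow> q ^ i / q ^ j = q ^ (i - j)"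
    "i < j \<Longrightarrow> q ^ i / q ^ j = 1 / q ^ (j - i)" for i j
    using q by (simp_all add: power_add power_diff)
  note W = weierstrass_three_term[of "q ^ 20" "q ^ a" "q ^ b" "q ^ c" "q ^ d" for a b c d]
  have 1: "q ^ 0 * q ^ 4 * (t 12 * t 4 * t 5 * t 5)
      + q ^ 5 * q ^ 4 * (t 13 * t 3 * t 4 * (- t 4 / q ^ 4))
      + q ^ 5 * q ^ 0 * (t 8 * t 8 * t 9 * (- t 1 / q ^ 1)) = 0"
    using W[of 8 4 5 0] norm_power_less_one[OF q(1), of 20] q(2)
    unfolding inv[symmetric] unfolding t_def by (simp add: *)
  have "q ^ 4 * (t 4 * t 5 ^ 2 * t 8 - t 1 * t 8 ^ 2 * t 9 - q * t 3 * t 4 ^ 2 * t 7) = 0"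
    using 1 q(2) unfolding refl by (simp add: field_simps eval_nat_numeral)
  then have "t 4 * t 5 ^ 2 * t 8 - t 1 * t 8 ^ 2 * t 9 - q * t 3 * t 4 ^ 2 * t 7 = 0"
    using q(2) by simp
  then show ?thesis by (simp add: algebra_simps)
qed

text \<open>Taking the fifth root \<open>s\<close> as variable makes the continued fraction
  single-valued.\<close>

definition rr_cfrac :: "complex \<Rightarrow> complex" where
  "rr_cfrac s = s * rogers_ramanujan_T (s ^ 5)"

text \<open>With k = q T1 T2^2, the base-10 identities evaluate both T2 (1 - k) and T1^2 (1 + k) as
  t1 t5 / t3^2, which is the first relation. The second is the base-20 identity rewritten in T1, T2
  and T(q^4).\<close>

lemma rogers_ramanujan_T_degree_2:
  assumes q: "norm q < 1" "q \<noteq> 0"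
  defines "T1 \<equiv> rogers_ramanujan_T q" and "T2 \<equiv> rogers_ramanujan_T (q ^ 2)"
  shows "T2 - T1 ^ 2 = (T2 + T1 ^ 2) * (q * T1 * T2 ^ 2)"
    and "T1 * rogers_ramanujan_T (q ^ 4) * (1 + q * T1 * T2 ^ 2)
       = T1 * T2 ^ 2 + q * T2 * rogers_ramanujan_T (q ^ 4) ^ 2"
proof -
  define t where "t j = jtheta (q ^ j) (q ^ 10)" for j
  define t' where "t' j = jtheta (q ^ j) (q ^ 20)" for j
  have split: "jtheta (q ^ j) (q ^ 5) = t j * t (j + 5)" for j
    using jtheta_power_split[OF q, of 5] by (simp add: t_def)
  have split': "t j = t' j * t' (j + 10)" for j
    using jtheta_power_split[OF q, of 10] by (simp add: t_def t'_def)
  have refl: "t 6 = t 4" "t 7 = t 3"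
    unfolding t_def using jtheta_power_reflect[OF q(2), of 4 10] jtheta_power_reflect[OF q(2), of 3 10] by simp_all
  have refl': "t' 11 = t' 9" "t' 13 = t' 7" "t' 15 = t' 5"
    unfolding t'_def using jtheta_power_reflect[OF q(2), of 9 20]
      jtheta_power_reflect[OF q(2), of 7 20] jtheta_power_reflect[OF q(2), of 5 20] by simp_all
  have nz: "t 1 \<noteq> 0" "t 2 \<noteq> 0" "t 3 \<noteq> 0" "t 4 \<noteq> 0"
    unfolding t_def by (intro jtheta_power_nonzero q; simp)+
  have nz': "t' 8 \<noteq> 0"
    unfolding t'_def by (intro jtheta_power_nonzero q; simp)+
  have T1: "T1 = t 1 * t 4 / (t 2 * t 3)"
    using split[of 1] split[of 2] by (simp add: T1_def rogers_ramanujan_T_jtheta q refl)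
  have T2: "T2 = t 2 / t 4"
    using q unfolding T2_def by (subst rogers_ramanujan_T_jtheta) (auto simp: t_def power_mult[symmetric])
  have T4: "rogers_ramanujan_T (q ^ 4) = t' 4 / t' 8"
    using q by (subst rogers_ramanujan_T_jtheta) (auto simp: t'_def power_mult[symmetric])
  have k: "q * T1 * T2 ^ 2 = q * t 1 * t 2 / (t 3 * t 4)"
    using nz by (simp add: T1 T2 field_simps power2_eq_square)
  note I = theta_identities_10[OF q, folded t_def]
  have "T2 * (1 - q * T1 * T2 ^ 2) = t 2 * t 3 * (t 3 * t 4 - q * t 1 * t 2) / (t 3 ^ 2 * t 4 ^ 2)"
    unfolding k using nz by (simp add: T2 field_simps power2_eq_square)
  also have "\<dots> = t 1 * t 5 / t 3 ^ 2"
    unfolding I using nz by (simp add: field_simps)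
  finally have a: "T2 * (1 - q * T1 * T2 ^ 2) = t 1 * t 5 / t 3 ^ 2" .
  have "1 + q * T1 * T2 ^ 2 = t 1 * t 4 * (t 3 * t 4 + q * t 1 * t 2) / (t 1 * t 3 * t 4 ^ 2)"
    unfolding k using nz by (simp add: field_simps power2_eq_square)
  also have "\<dots> = t 2 ^ 2 * t 5 / (t 1 * t 4 ^ 2)"
    unfolding I using nz by (simp add: field_simps)
  finally have b: "1 + q * T1 * T2 ^ 2 = t 2 ^ 2 * t 5 / (t 1 * t 4 ^ 2)" .
  have "T1 ^ 2 * (1 + q * T1 * T2 ^ 2) = t 1 * t 5 / t 3 ^ 2"
    unfolding b unfolding T1 using nz by (simp add: field_simps power2_eq_square)
  with a show "T2 - T1 ^ 2 = (T2 + T1 ^ 2) * (q * T1 * T2 ^ 2)"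
    by algebra
  \<comment> \<open>Splitting and reflection give t1 = t'1 t'9, t3 = t'3 t'7 and t5 = t'5^2, so the
    identity needs only \<open>t' 4\<close> and \<open>t' 8\<close> from base
    \<open>q ^ 20\<close>.\<close>
  have "t' 4 * t' 8 * t 5 = t 1 * t' 8 ^ 2 + q * t 3 * t' 4 ^ 2"
    using theta_identity_20[OF q, folded t'_def] split'[of 1] split'[of 3] split'[of 5]
    by (simp add: refl' power2_eq_square mult_ac)
  then have *: "t 5 * t' 4 / t' 8 = t 1 + q * t 3 * (t' 4 / t' 8) ^ 2"
    using nz' by (simp add: field_simps power2_eq_square)
  have "T1 * rogers_ramanujan_T (q ^ 4) * (1 + q * T1 * T2 ^ 2) = t 2 / (t 3 * t 4) * (t 5 * t' 4 / t' 8)"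
    unfolding b T4 unfolding T1 using nz by (simp add: field_simps power2_eq_square)
  also have "\<dots> = T1 * T2 ^ 2 + q * T2 * rogers_ramanujan_T (q ^ 4) ^ 2"
    unfolding * T4 T1 T2 using nz by (simp add: field_simps power2_eq_square)
  finally show "T1 * rogers_ramanujan_T (q ^ 4) * (1 + q * T1 * T2 ^ 2)
       = T1 * T2 ^ 2 + q * T2 * rogers_ramanujan_T (q ^ 4) ^ 2" .
qed

text \<open>The factors s, s^2, s^4 absorb the explicit q = s^5 of the relations for T.\<close>

lemma rr_cfrac_degree_2:
  assumes s: "norm s < 1" "s \<noteq> 0"
  defines "u \<equiv> rr_cfrac s" and "v \<equiv> rr_cfrac (s ^ 2)" and "w \<equiv> rr_cfrac (s ^ 4)"
  shows "v - u ^ 2 = (v + u ^ 2) * (u * v ^ 2)"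
    and "u * w * (1 + u * v ^ 2) = u * v ^ 2 + v * w ^ 2"
proof -
  define T1 T2 T4 where "T1 = rogers_ramanujan_T (s ^ 5)" and "T2 = rogers_ramanujan_T ((s ^ 5) ^ 2)"
    and "T4 = rogers_ramanujan_T ((s ^ 5) ^ 4)"
  have u: "u = s * T1" and v: "v = s ^ 2 * T2" and w: "w = s ^ 4 * T4"
    unfolding u_def v_def w_def rr_cfrac_def T1_def T2_def T4_def by (simp_all add: power_mult[symmetric])
  have "norm (s ^ 5) < 1" "s ^ 5 \<noteq> 0" using s norm_power_less_one by auto
  note T = rogers_ramanujan_T_degree_2[OF this, folded T1_def T2_def T4_def]
  show "v - u ^ 2 = (v + u ^ 2) * (u * v ^ 2)"
    unfolding u v using T(1) by algebra
  show "u * w * (1 + u * v ^ 2) = u * v ^ 2 + v * w ^ 2"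
    unfolding u v w using T(2) by algebra
qed

section \<open>The modular equation of degree 5\<close>

lemma has_sum_residue_classes:
  fixes f :: "int \<Rightarrow> complex"
  assumes "m > 0" and S: "\<And>r. r < m \<Longrightarrow> ((\<lambda>n. f (int m * n + int r)) has_sum S r) UNIV"
  shows "(f has_sum (\<Sum>r<m. S r)) UNIV"
proof -
  have "((\<lambda>j. if j mod int m = int r then f j else 0) has_sum S r) UNIV" if "r < m" for r
  proof -
    have "(f has_sum S r) {j. j mod int m = int r}"
      using S[OF that]
    proof (rule has_sum_reindex_bij_witness[of _ "\<lambda>j. j div int m" "\<lambda>n. int m * n + int r", THEN iffD1, rotated -1])
      fix j assume "j \<in> {j. j mod int m = int r}"
      then show "int m * (j div int m) + int r = j"
        by (metis mem_Collect_eq mult_div_mod_eq)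
    qed (use that in auto)
    then show ?thesis
      by (subst (asm) has_sum_cong_neutral[of UNIV _ "\<lambda>j. if j mod int m = int r then f j else 0"]) auto
  qed
  then have "((\<lambda>j. \<Sum>r<k. if j mod int m = int r then f j else 0) has_sum (\<Sum>r<k. S r)) UNIV"
    if "k \<le> m" for k
    using that by (induction k) (simp_all add: has_sum_add)
  from this[OF order_refl]
  have "((\<lambda>j. \<Sum>r<m. if j mod int m = int r then f j else 0) has_sum (\<Sum>r<m. S r)) UNIV" .
  moreover have "(\<Sum>r<m. if j mod int m = int r then f j else 0) = f j" for j
  proof -
    have "j mod int m = int r \<longleftrightarrow> r = nat (j mod int m)" for r
      using assms(1) by auto
    moreover have "nat (j mod int m) < m" using assms(1) by (simp add: nat_less_iff)
    ultimately show ?thesis by simp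
  qed
  ultimately show ?thesis by simp
qed

text \<open>With C(i) = i (i - 1) / 2, C(5n + r) = C(r) + (10 + 5r) n + 25 C(n), and z^(5n) = 1. So
  each residue class is again a theta series, in base \<open>q ^ 25\<close>, and \<open>z\<close>
  survives only in the constant factor.\<close>

lemma jacobi_term_residue:
  assumes "z \<noteq> 0" "q \<noteq> 0" "z ^ 5 = 1"
  shows "jacobi_term z q (5 * n + int r) = jacobi_term z q (int r) * jacobi_term (q ^ (10 + 5 * r)) (q ^ 25) n"
proof -
  have two: "2 * (i * (i - 1) div 2) = i * (i - 1)" for i :: int by simp
  have "2 * ((5 * n + int r) * (5 * n + int r - 1) div 2)
      = 2 * (int r * (int r - 1) div 2 + (int (10 + 5 * r) * n + 25 * (n * (n - 1) div 2)))"
    unfolding distrib_left two mult.left_commute[of 2 25] by (simp add: algebra_simps)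
  then have e: "(5 * n + int r) * (5 * n + int r - 1) div 2
      = int r * (int r - 1) div 2 + (int (10 + 5 * r) * n + 25 * (n * (n - 1) div 2))"
    by (simp only: mult_cancel_left) simp
  have "(- z) powi (5 * n + int r) = (- z) powi int r * (- 1) powi n"
  proof -
    have "(- z) powi (5 * n) = ((- z) ^ 5) powi n"
      using power_int_power[of "- z" 5 n] by simp
    also have "(- z) ^ 5 = - 1" using assms(3) by simp
    finally show ?thesis using assms(1) by (simp add: power_int_add)
  qed
  moreover have "(- (q ^ (10 + 5 * r))) powi n = (- 1) powi n * q powi (int (10 + 5 * r) * n)"
    unfolding power_int_minus_left[of "q ^ (10 + 5 * r)"] power_int_power[symmetric]
    by (simp add: power_int_minus_left)
  moreover have "(q ^ 25) powi i = q powi (25 * i)" for i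
    using power_int_power[of q 25 i] by simp
  ultimately show ?thesis
    using assms unfolding jacobi_term_def e power_int_add[OF disjI1[OF assms(2)]] by simp
qed

text \<open>Class 3 vanishes, classes 0 and 1 both give \<open>t 10\<close>, and classes 2 and 4
  both give \<open>t 5\<close> up to a monomial factor; \<open>t 5 / t 10\<close> is T(q^5).\<close>

lemma jtheta_dissection:
  assumes q: "norm q < 1" "q \<noteq> 0" and w: "w ^ 5 = 1" "w \<noteq> 1"
  shows "jtheta w q * qpochhammer_inf q q
       = (1 - w) * (qpochhammer_inf (q ^ 25) (q ^ 25) * jtheta (q ^ 10) (q ^ 25)
           * (1 + (w ^ 2 + w ^ 3) * rr_cfrac q))"
proof -
  have w0: "w \<noteq> 0" using w by auto
  have q25: "norm (q ^ 25) < 1" "q ^ 25 \<noteq> 0" using norm_power_less_one q by auto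
  define t where "t j = jtheta (q ^ j) (q ^ 25)" for j
  define e where "e = qpochhammer_inf (q ^ 25) (q ^ 25)"
  have "(jacobi_term w q has_sum (\<Sum>r<5. jacobi_term w q (int r) * (t (10 + 5 * r) * e))) UNIV"
  proof (rule has_sum_residue_classes)
    fix r :: nat
    show "((\<lambda>n. jacobi_term w q (int 5 * n + int r)) has_sum (jacobi_term w q (int r) * (t (10 + 5 * r) * e))) UNIV"
      unfolding t_def e_def of_nat_numeral jacobi_term_residue[OF w0 q(2) w(1)]
      by (intro has_sum_cmult_right jtheta_has_sum q25) (use q in auto)
  qed simp
  then have "jtheta w q * qpochhammer_inf q q = (\<Sum>r<5. jacobi_term w q (int r) * (t (10 + 5 * r) * e))"
    using jtheta_has_sum[OF q w0] has_sum_unique by blast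
  also have "\<dots> = (t 10 - w * t 15 + w ^ 2 * q * t 20 - w ^ 3 * q ^ 3 * t 25 + w ^ 4 * q ^ 6 * t 30) * e"
    by (simp add: eval_nat_numeral jacobi_term_def algebra_simps)
  also have "t 15 = t 10"
    unfolding t_def using jtheta_power_reflect[OF q(2), of 10 25] by simp
  also have "t 20 = t 5"
    unfolding t_def using jtheta_power_reflect[OF q(2), of 5 25] by simp
  also have "t 25 = 0"
    using jtheta_power_reflect[OF q(2), of 0 25] q25 by (simp add: t_def)
  also have "t 30 = - t 5 / q ^ 5"
    using jtheta_shift[OF q25, of "q ^ 5"] q by (simp add: t_def power_add[symmetric])
  \<comment> \<open>Uses \<open>w ^ 2 - w ^ 4 = (1 - w) * (w ^ 2 + w ^ 3)\<close>.\<close>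
  also have "(t 10 - w * t 10 + w ^ 2 * q * t 5 - w ^ 3 * q ^ 3 * 0 + w ^ 4 * q ^ 6 * (- t 5 / q ^ 5)) * e
      = (1 - w) * (e * (t 10 + (w ^ 2 + w ^ 3) * (q * t 5)))"
    using q by (simp add: field_simps eval_nat_numeral)
  also have "q * t 5 = t 10 * rr_cfrac q"
  proof -
    have "t 10 \<noteq> 0" unfolding t_def by (rule jtheta_power_nonzero) (use q in auto)
    moreover have "rogers_ramanujan_T (q ^ 5) = t 5 / t 10"
      using q by (subst rogers_ramanujan_T_jtheta) (auto simp: t_def power_mult[symmetric])
    ultimately show ?thesis by (simp add: rr_cfrac_def)
  qed
  finally show ?thesis by (simp add: e_def t_def algebra_simps)
qed

text \<open>Only used for \<open>w ^ 5 = 1\<close>, so that \<open>w ^ 4\<close> stands for \<open>1 / w\<close>.\<close>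

definition cyclotomic_theta :: "complex \<Rightarrow> complex \<Rightarrow> complex" where
  "cyclotomic_theta w q = qpochhammer_inf q q * qpochhammer_inf (w * q) q * qpochhammer_inf (w ^ 4 * q) q"

text \<open>The dissection with the factor \<open>1 - w\<close> cancelled.\<close>

lemma cyclotomic_theta_eq:
  assumes q: "norm q < 1" "q \<noteq> 0" and w: "w ^ 5 = 1" "w \<noteq> 1"
  shows "cyclotomic_theta w q = qpochhammer_inf (q ^ 25) (q ^ 25) * jtheta (q ^ 10) (q ^ 25)
           * (1 + (w ^ 2 + w ^ 3) * rr_cfrac q)"
proof -
  have "w \<noteq> 0" using w by auto
  moreover have "w ^ 4 * q * w = q" using w(1) by algebra
  ultimately have "q / w = w ^ 4 * q" by (simp add: divide_eq_eq)
  then have "jtheta w q * qpochhammer_inf q q = (1 - w) * cyclotomic_theta w q"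
    using qpochhammer_inf_rec[OF q(1), of w] by (simp add: jtheta_def cyclotomic_theta_def mult_ac)
  then show ?thesis using jtheta_dissection[OF q w] w by simp
qed

section \<open>Products over the fifth roots of unity\<close>

lemma nontrivial_fifth_root_of_unity:
  obtains z :: complex where "z ^ 5 = 1" "z \<noteq> 1"
proof (rule that)
  show "cis (2 * pi / 5) ^ 5 = 1" unfolding Complex.DeMoivre by simp
  show "cis (2 * pi / 5) \<noteq> 1"
  proof
    assume "cis (2 * pi / 5) = 1"
    then have "cos (2 * pi / 5) = 1" by (metis cis.sel(1) one_complex.sel(1))
    then show False using cos_monotone_0_pi[of 0 "2 * pi / 5"] by simp
  qed
qed

lemma norm_fifth_root_of_unity: "(w :: complex) ^ 5 = 1 \<Longrightarrow> norm w = 1"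
  by (metis norm_ge_zero norm_one norm_power power_eq_iff_eq_base power_one zero_le_one zero_less_numeral)

text \<open>No factor vanishes since \<open>norm w = 1\<close>. For \<open>w\<close> other than 1,
  the dissection then yields \<open>1 + (w ^ 2 + w ^ 3) * rr_cfrac q \<noteq> 0\<close>.\<close>

lemma cyclotomic_theta_nonzero:
  assumes q: "norm q < 1" and w: "w ^ 5 = 1"
  shows "cyclotomic_theta w q \<noteq> 0"
proof -
  have "norm w = 1" using w by (rule norm_fifth_root_of_unity)
  then show ?thesis
    using q unfolding cyclotomic_theta_def
    by (auto simp: norm_mult norm_power dest!: qpochhammer_inf_nonzero'[OF q, THEN notE, rotated])
qed

text \<open>Split each factor by exponents modulo 5; the new base is \<open>q\<close> for every
  \<open>i\<close>. In the four classes with exponent prime to 5 the product over \<open>i\<close>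
  runs over all fifth roots and collapses to base \<open>q ^ 5\<close>; with the extra factor they
  recombine to \<open>qpochhammer_inf q q\<close>. The fifth class is independent of
  \<open>i\<close>.\<close>

lemma prod_qpochhammer_cyclotomic:
  assumes s: "norm s < 1" and z: "z ^ 5 = 1" "z \<noteq> 1" and a: "a ^ 5 = 1"
  defines "q \<equiv> s ^ 5"
  shows "(\<Prod>i<5. qpochhammer_inf (a * (z ^ i * s)) (z ^ i * s)) * qpochhammer_inf (q ^ 5) (q ^ 5)
       = qpochhammer_inf q q * qpochhammer_inf (a * q) q ^ 5"
proof -
  have nz: "norm z = 1" using z(1) by (rule norm_fifth_root_of_unity)
  have q: "norm q < 1" unfolding q_def using norm_power_less_one[OF s] by simp
  have zi: "(z ^ i) ^ 5 = 1" for i by (metis mult.commute power_mult power_one z(1))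
  have "(\<Prod>i<5. qpochhammer_inf (a * (z ^ i * s)) (z ^ i * s))
      = (\<Prod>i<5. \<Prod>r<5. qpochhammer_inf ((z ^ Suc r) ^ i * (a * s ^ Suc r)) q)"
  proof (rule prod.cong[OF refl])
    fix i
    have "norm (z ^ i * s) < 1" using s nz by (simp add: norm_mult norm_power)
    then have "qpochhammer_inf (a * (z ^ i * s)) (z ^ i * s)
        = (\<Prod>r<5. qpochhammer_inf (a * (z ^ i * s) * (z ^ i * s) ^ r) ((z ^ i * s) ^ 5))"
      by (rule qpochhammer_inf_split) simp
    also have "(z ^ i * s) ^ 5 = q" by (simp add: power_mult_distrib zi q_def)
    also have "(\<Prod>r<5. qpochhammer_inf (a * (z ^ i * s) * (z ^ i * s) ^ r) q)
        = (\<Prod>r<5. qpochhammer_inf ((z ^ Suc r) ^ i * (a * s ^ Suc r)) q)"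
      by (simp add: power_mult_distrib power_mult[symmetric] mult_ac)
    finally show "qpochhammer_inf (a * (z ^ i * s)) (z ^ i * s)
        = (\<Prod>r<5. qpochhammer_inf ((z ^ Suc r) ^ i * (a * s ^ Suc r)) q)" .
  qed
  also have "\<dots> = (\<Prod>r<5. \<Prod>i<5. qpochhammer_inf ((z ^ Suc r) ^ i * (a * s ^ Suc r)) q)"
    by (rule prod.swap)
  also have "\<dots> = (\<Prod>r<4. \<Prod>i<5. qpochhammer_inf ((z ^ Suc r) ^ i * (a * s ^ Suc r)) q)
      * (\<Prod>i<5. qpochhammer_inf ((z ^ 5) ^ i * (a * s ^ 5)) q)"
    using prod.lessThan_Suc[of "\<lambda>r. \<Prod>i<5. qpochhammer_inf ((z ^ Suc r) ^ i * (a * s ^ Suc r)) q" 4] by simp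
  also have "(\<Prod>i<5. qpochhammer_inf ((z ^ 5) ^ i * (a * s ^ 5)) q) = qpochhammer_inf (a * q) q ^ 5"
    by (simp add: z q_def)
  also have "(\<Prod>r<4. \<Prod>i<5. qpochhammer_inf ((z ^ Suc r) ^ i * (a * s ^ Suc r)) q)
      = (\<Prod>r<4. qpochhammer_inf (q * q ^ r) (q ^ 5))"
  proof (rule prod.cong[OF refl])
    fix r :: nat assume "r \<in> {..<4}"
    then have "r \<in> {0, 1, 2, 3}" by auto
    \<comment> \<open>The exponent \<open>Suc r\<close> lies between 1 and 4, hence is prime to
      5.\<close>
    then have "z = 1" if "z ^ Suc r = 1"
    proof (elim insertE emptyE)
      assume "r = 0"
      then show "z = 1" using that by simp
    next
      assume "r = 1"
      then have "z ^ 2 = 1" using that by (simp add: power2_eq_square)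
      then show "z = 1" using z(1) by algebra
    next
      assume "r = 2"
      then have "z ^ 3 = 1" using that by (simp add: power3_eq_cube)
      then show "z = 1" using z(1) by algebra
    next
      assume "r = 3"
      then have "z ^ 4 = 1" using that by (simp add: eval_nat_numeral)
      then show "z = 1" using z(1) by algebra
    qed
    with z(2) have "z ^ Suc r \<noteq> 1" by blast
    then have "(\<Prod>i<5. qpochhammer_inf ((z ^ Suc r) ^ i * (a * s ^ Suc r)) q)
        = qpochhammer_inf ((a * s ^ Suc r) ^ 5) (q ^ 5)"
      by (intro prod_qpochhammer_root_of_unity_5 zi q)
    also have "(a * s ^ Suc r) ^ 5 = q * q ^ r"
      using a by (simp add: power_mult_distrib q_def power_mult[symmetric] mult.commute)
    finally show "(\<Prod>i<5. qpochhammer_inf ((z ^ Suc r) ^ i * (a * s ^ Suc r)) q) = qpochhammer_inf (q * q ^ r) (q ^ 5)" .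
  qed
  finally show ?thesis
    using qpochhammer_inf_split[OF q, of 5 q] by (simp add: eval_nat_numeral mult_ac)
qed

text \<open>Multiply the dissections at \<open>z ^ i * s\<close> over \<open>i < 5\<close> for a fifth root of unity \<open>z \<noteq> 1\<close>.\<close>

lemma rr_cfrac_golden_fifth_power:
  assumes s: "norm s < 1" "s \<noteq> 0"
  obtains M where "M \<noteq> 0"
    "\<And>w. w ^ 5 = 1 \<Longrightarrow> w \<noteq> 1 \<Longrightarrow>
       1 + (w ^ 2 + w ^ 3) ^ 5 * rr_cfrac s ^ 5 = M * (1 + (w ^ 2 + w ^ 3) * rr_cfrac (s ^ 5)) ^ 5"
proof -
  define q where "q = s ^ 5"
  have q: "norm q < 1" "q \<noteq> 0" unfolding q_def using s norm_power_less_one by auto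
  have q5: "norm (q ^ 5) < 1" "q ^ 5 \<noteq> 0" using q norm_power_less_one by auto
  obtain z :: complex where z: "z ^ 5 = 1" and z1: "z \<noteq> 1"
    by (rule nontrivial_fifth_root_of_unity)
  define A where "A = qpochhammer_inf (q ^ 5) (q ^ 5) * jtheta (q ^ 2) (q ^ 5)"
  define B where "B = qpochhammer_inf (q ^ 25) (q ^ 25) * jtheta (q ^ 10) (q ^ 25)"
  define E where "E = qpochhammer_inf q q"
  define E5 where "E5 = qpochhammer_inf (q ^ 5) (q ^ 5)"
  have A0: "A \<noteq> 0" unfolding A_def using qpochhammer_inf_nonzero'[OF q5(1) q5(1)]
    jtheta_power_nonzero[OF q, of 2 5] by simp
  have B0: "B \<noteq> 0" unfolding B_def using qpochhammer_inf_nonzero'[of "q ^ 25" "q ^ 25"]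
    jtheta_power_nonzero[OF q, of 10 25] norm_power_less_one[OF q(1), of 25] by simp
  have E0: "E \<noteq> 0" "E5 \<noteq> 0"
    unfolding E_def E5_def using qpochhammer_inf_nonzero' q q5 by auto
  have nz: "norm z = 1" using z by (rule norm_fifth_root_of_unity)
  have zi: "(z ^ i) ^ 5 = 1" for i by (metis mult.commute power_mult power_one z(1))
  \<comment> \<open>The factor found here is free of \<open>w\<close>; this will allow its
    elimination between two choices of \<open>w\<close>.\<close>
  have main: "1 + (w ^ 2 + w ^ 3) ^ 5 * rr_cfrac s ^ 5
      = (E ^ 3 * B ^ 5 / (E5 ^ 3 * A ^ 5)) * (1 + (w ^ 2 + w ^ 3) * rr_cfrac (s ^ 5)) ^ 5"
    if w: "w ^ 5 = 1" "w \<noteq> 1" for w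
  proof -
    define c where "c = w ^ 2 + w ^ 3"
    have w4: "(w ^ 4) ^ 5 = 1" using w by (metis mult.commute power_mult power_one)
    \<comment> \<open>The prefactor depends only on the fifth power of the argument, so it is
      \<open>A\<close> for all \<open>i\<close>, and \<open>rr_cfrac\<close> is multiplied by
      \<open>z ^ i\<close>.\<close>
    have K: "cyclotomic_theta w (z ^ i * s) = A * (1 - z ^ i * (- (c * rr_cfrac s)))" for i
    proof -
      have "norm (z ^ i * s) < 1" "z ^ i * s \<noteq> 0" using s nz by (auto simp: norm_mult norm_power)
      moreover have "(z ^ i * s) ^ 5 = q" by (simp add: power_mult_distrib zi q_def)
      moreover from this have "(z ^ i * s) ^ 25 = q ^ 5" "(z ^ i * s) ^ 10 = q ^ 2"
        using power_mult[of "z ^ i * s" 5 5] power_mult[of "z ^ i * s" 5 2] by simp_all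
      ultimately show ?thesis
        using cyclotomic_theta_eq[of "z ^ i * s" w] w
        by (simp add: A_def c_def rr_cfrac_def q_def mult_ac)
    qed
    have "(\<Prod>i<5. cyclotomic_theta w (z ^ i * s)) = A ^ 5 * (1 - (- (c * rr_cfrac s)) ^ 5)"
      unfolding K prod.distrib prod_root_of_unity_5[OF z z1] by simp
    also have "\<dots> = A ^ 5 * (1 + c ^ 5 * rr_cfrac s ^ 5)" by (simp add: power_mult_distrib)
    finally have 1: "(\<Prod>i<5. cyclotomic_theta w (z ^ i * s)) = A ^ 5 * (1 + c ^ 5 * rr_cfrac s ^ 5)" .
    note P = prod_qpochhammer_cyclotomic[OF s(1) z z1, folded q_def]
    \<comment> \<open>One factor \<open>E5\<close> for each of the three products, with
      \<open>a\<close> equal to \<open>1\<close>, \<open>w\<close> and \<open>w ^ 4\<close>.\<close>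
    have "(\<Prod>i<5. cyclotomic_theta w (z ^ i * s)) * E5 ^ 3
        = ((\<Prod>i<5. qpochhammer_inf (1 * (z ^ i * s)) (z ^ i * s)) * E5)
        * ((\<Prod>i<5. qpochhammer_inf (w * (z ^ i * s)) (z ^ i * s)) * E5)
        * ((\<Prod>i<5. qpochhammer_inf (w ^ 4 * (z ^ i * s)) (z ^ i * s)) * E5)"
      by (simp add: cyclotomic_theta_def prod.distrib power3_eq_cube mult_ac)
    also have "\<dots> = E ^ 3 * cyclotomic_theta w q ^ 5"
      unfolding E5_def P[OF power_one] P[OF w(1)] P[OF w4]
      by (simp add: cyclotomic_theta_def E_def power3_eq_cube power_mult_distrib mult_ac)
    also have "cyclotomic_theta w q = B * (1 + c * rr_cfrac (s ^ 5))"
      unfolding B_def c_def q_def[symmetric] by (rule cyclotomic_theta_eq[OF q w])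
    finally have "E5 ^ 3 * A ^ 5 * (1 + c ^ 5 * rr_cfrac s ^ 5) = E ^ 3 * B ^ 5 * (1 + c * rr_cfrac (s ^ 5)) ^ 5"
      unfolding 1 power_mult_distrib by (simp only: mult_ac)
    moreover have "E5 ^ 3 * A ^ 5 \<noteq> 0" using A0 E0 by simp
    moreover have "x = a / b * y" if "b * x = a * y" "b \<noteq> 0" for a b x y :: complex
      using that by (simp add: field_simps)
    ultimately show ?thesis
      unfolding c_def[symmetric] by blast
  qed
  show thesis by (rule that[OF _ main]) (use A0 B0 E0 in auto)
qed

section \<open>Algebraic consequences\<close>

text \<open>\<open>param_den\<close> and \<open>param_num\<close> are D and N of the third identity,
  with U = R(q^5) and V = R(q^10).\<close>

definition param_den :: "complex \<Rightarrow> complex \<Rightarrow> complex" where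
  "param_den U V = U * (1 + U * V ^ 2 - U ^ 2 * V ^ 4)"

definition param_num :: "complex \<Rightarrow> complex \<Rightarrow> complex" where
  "param_num U V = 1 + U + U ^ 2 + 2 * U * V + 2 * U ^ 2 * V - 2 * U * V ^ 2 + 2 * U ^ 3 * V ^ 2
     - 2 * U ^ 2 * V ^ 3 + 2 * U ^ 3 * V ^ 3 + U ^ 2 * V ^ 4 - U ^ 3 * V ^ 4 + U ^ 4 * V ^ 4"

text \<open>For U = r(s^5), V = r(s^10) and k = n/d this becomes r(s)^5 = k (1 - k)^2 / (1 + k)^2,
  once r(s)^5 is expressed through U.\<close>

lemma param_fifth_power_1:
  fixes U V :: complex
  assumes "V - U ^ 2 = (V + U ^ 2) * (U * V ^ 2)"
  defines "n \<equiv> U - V + V ^ 2 + U ^ 2 * V ^ 2" and "d \<equiv> 1 + V + V ^ 2 + U * V ^ 2"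
  shows "n * (d - n) ^ 2 * (1 + 3 * U + 4 * U ^ 2 + 2 * U ^ 3 + U ^ 4)
       = U * (1 - 2 * U + 4 * U ^ 2 - 3 * U ^ 3 + U ^ 4) * (d + n) ^ 2 * d"
  using assms(1) unfolding n_def d_def by algebra

text \<open>The companion r(s^2)^5 = k^2 (1 + k) / (1 - k), with r(s^2)^5 expressed through
  V.\<close>

lemma param_fifth_power_2:
  fixes U V :: complex
  assumes "V - U ^ 2 = (V + U ^ 2) * (U * V ^ 2)"
  defines "n \<equiv> U - V + V ^ 2 + U ^ 2 * V ^ 2" and "d \<equiv> 1 + V + V ^ 2 + U * V ^ 2"
  shows "V * (1 - 2 * V + 4 * V ^ 2 - 3 * V ^ 3 + V ^ 4) * (d - n) * d ^ 2
       = (1 + 3 * V + 4 * V ^ 2 + 2 * V ^ 3 + V ^ 4) * n ^ 2 * (d + n)"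
  using assms(1) unfolding n_def d_def by algebra

text \<open>The third identity for k = n/d, multiplied by \<open>d ^ 2\<close>.\<close>

lemma param_relation:
  fixes U V :: complex
  assumes "V - U ^ 2 = (V + U ^ 2) * (U * V ^ 2)"
  defines "n \<equiv> U - V + V ^ 2 + U ^ 2 * V ^ 2" and "d \<equiv> 1 + V + V ^ 2 + U * V ^ 2"
  shows "(d ^ 2 - n ^ 2) * param_den U V = param_num U V * n * d"
  using assms(1) unfolding n_def d_def param_den_def param_num_def by algebra

text \<open>With k = n/d and l = n'/d' the values of the parameter at s and s^2, this says that (k +
  l) / (1 + k) is the right-hand side of the first identity.\<close>

lemma param_relation_product:
  fixes U V :: complex
  assumes "V - U ^ 2 = (V + U ^ 2) * (U * V ^ 2)" "W - V ^ 2 = (W + V ^ 2) * (V * W ^ 2)"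
    and "U * W * (1 + U * V ^ 2) = U * V ^ 2 + V * W ^ 2"
  defines "n \<equiv> U - V + V ^ 2 + U ^ 2 * V ^ 2" and "d \<equiv> 1 + V + V ^ 2 + U * V ^ 2"
    and "n' \<equiv> V * (1 - 2 * W + W ^ 2 + V * W)" and "d' \<equiv> 1 + V - V ^ 2 * W"
  shows "(U + W - U * W) * (d + n) * d' = (1 + U + W) * (n * d' + n' * d)"
  using assms(1-3) unfolding n_def d_def n'_def d'_def by algebra

text \<open>The second identity in the form k g / l, where g = r(s) r(s^4) is replaced by its value
  from the first identity.\<close>

lemma param_relation_quotient:
  fixes U V :: complex
  assumes "V - U ^ 2 = (V + U ^ 2) * (U * V ^ 2)" "W - V ^ 2 = (W + V ^ 2) * (V * W ^ 2)"
    and "U * W * (1 + U * V ^ 2) = U * V ^ 2 + V * W ^ 2"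
  defines "n \<equiv> U - V + V ^ 2 + U ^ 2 * V ^ 2" and "d \<equiv> 1 + V + V ^ 2 + U * V ^ 2"
    and "n' \<equiv> V * (1 - 2 * W + W ^ 2 + V * W)" and "d' \<equiv> 1 + V - V ^ 2 * W"
  shows "n * d' * (U + W - U * W) * (U * V + W + U * W) = n' * d * U * (V - U * V + W) * (1 + U + W)"
  using assms(1-3) unfolding n_def d_def n'_def d'_def by algebra

section \<open>The identities\<close>

lemma rogers_ramanujan_T_nonzero:
  assumes "norm q < 1"
  shows "rogers_ramanujan_T q \<noteq> 0"
proof -
  have "qpochhammer_inf (q ^ j) (q ^ 5) \<noteq> 0" if "j > 0" for j
    by (rule qpochhammer_inf_nonzero') (use assms norm_power_less_one that in auto)
  from this[of 1] this[of 2] this[of 3] this[of 4] show ?thesis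
    by (simp add: rogers_ramanujan_T_def rogers_ramanujan_G_def rogers_ramanujan_H_def)
qed

lemma holomorphic_rogers_ramanujan_T: "rogers_ramanujan_T holomorphic_on ball 0 1"
proof -
  have h: "(\<lambda>q. qpochhammer_inf (q ^ j) (q ^ 5)) holomorphic_on ball 0 1" for j
    by (rule holomorphic_qpochhammer_inf) simp
  have nz: "qpochhammer_inf (q ^ j) (q ^ 5) \<noteq> 0" if "j > 0" "q \<in> ball 0 1" for q :: complex and j
    by (rule qpochhammer_inf_nonzero') (use norm_power_less_one[of q] that in auto)
  have "(\<lambda>q. qpochhammer_inf (q ^ 1) (q ^ 5) * qpochhammer_inf (q ^ 4) (q ^ 5) /
      (qpochhammer_inf (q ^ 2) (q ^ 5) * qpochhammer_inf (q ^ 3) (q ^ 5))) holomorphic_on ball 0 1"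
    by (intro holomorphic_intros h) (use nz in auto)
  then show ?thesis
    by (simp add: rogers_ramanujan_T_def[abs_def] rogers_ramanujan_G_def rogers_ramanujan_H_def)
qed

lemma rogers_ramanujan_T_0 [simp]: "rogers_ramanujan_T 0 = 1"
  by (simp add: rogers_ramanujan_T_def rogers_ramanujan_G_def rogers_ramanujan_H_def)

lemma holomorphic_rogers_ramanujan_T_power:
  assumes "n > 0"
  shows "(\<lambda>s. rogers_ramanujan_T (s ^ n)) holomorphic_on ball 0 1"
proof -
  have "rogers_ramanujan_T \<circ> (\<lambda>s. s ^ n) holomorphic_on ball 0 1"
  proof (rule holomorphic_on_compose_gen[OF _ holomorphic_rogers_ramanujan_T])
    show "(\<lambda>s. s ^ n) ` ball 0 1 \<subseteq> ball (0 :: complex) 1"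
      using norm_power_less_one assms by auto
  qed (intro holomorphic_intros)
  then show ?thesis by (simp add: o_def)
qed

lemma tendsto_rogers_ramanujan_T_power:
  assumes "n > 0"
  shows "((\<lambda>s. rogers_ramanujan_T (s ^ n)) \<longlongrightarrow> 1) (at 0)"
proof -
  have "continuous_on (ball 0 1) (\<lambda>s. rogers_ramanujan_T (s ^ n))"
    by (rule holomorphic_on_imp_continuous_on[OF holomorphic_rogers_ramanujan_T_power[OF assms]])
  then have "isCont (\<lambda>s. rogers_ramanujan_T (s ^ n)) 0"
    by (simp add: continuous_on_eq_continuous_at)
  then show ?thesis using assms by (simp add: isCont_def power_0_left)
qed

lemma rr_cfrac_power: "rr_cfrac (s ^ n) = s ^ n * rogers_ramanujan_T (s ^ (5 * n))"
  by (simp add: rr_cfrac_def power_mult[symmetric] mult.commute)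

lemma holomorphic_rr_cfrac_power:
  assumes "n > 0"
  shows "(\<lambda>s. rr_cfrac (s ^ n)) holomorphic_on ball 0 1"
  unfolding rr_cfrac_power using assms
  by (intro holomorphic_intros holomorphic_rogers_ramanujan_T_power) auto

lemma tendsto_rr_cfrac_power:
  assumes "n > 0"
  shows "((\<lambda>s. rr_cfrac (s ^ n)) \<longlongrightarrow> 0) (at 0)"
proof -
  have "((\<lambda>s. s ^ n * rogers_ramanujan_T (s ^ (5 * n))) \<longlongrightarrow> 0 ^ n * 1) (at 0)"
    using assms by (intro tendsto_intros tendsto_rogers_ramanujan_T_power) auto
  then show ?thesis using assms by (simp add: rr_cfrac_power power_0_left)
qed

lemma rr_cfrac_nonzero: "norm s < 1 \<Longrightarrow> s \<noteq> 0 \<Longrightarrow> rr_cfrac s \<noteq> 0"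
  using rogers_ramanujan_T_nonzero[OF norm_power_less_one, of s 5] by (simp add: rr_cfrac_def)

text \<open>The choices \<open>w = z\<close> and \<open>w = z ^ 2\<close> for a primitive
  \<open>z\<close> give the two roots \<open>c\<close> and \<open>- 1 - c\<close> of X^2 + X - 1,
  with the same \<open>M\<close>.\<close>

lemma rr_cfrac_fifth_power_cases:
  assumes s: "norm s < 1" "s \<noteq> 0"
  obtains c M where "c ^ 2 + c = 1" "M \<noteq> 0"
    "1 + c ^ 5 * rr_cfrac s ^ 5 = M * (1 + c * rr_cfrac (s ^ 5)) ^ 5"
    "1 + (- 1 - c) ^ 5 * rr_cfrac s ^ 5 = M * (1 + (- 1 - c) * rr_cfrac (s ^ 5)) ^ 5"
    "1 + c * rr_cfrac s \<noteq> 0" "1 + (- 1 - c) * rr_cfrac s \<noteq> 0"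
proof -
  obtain M where M: "M \<noteq> 0" "\<And>w. w ^ 5 = 1 \<Longrightarrow> w \<noteq> 1 \<Longrightarrow>
      1 + (w ^ 2 + w ^ 3) ^ 5 * rr_cfrac s ^ 5 = M * (1 + (w ^ 2 + w ^ 3) * rr_cfrac (s ^ 5)) ^ 5"
    using rr_cfrac_golden_fifth_power[OF s] by blast
  obtain z :: complex where z: "z ^ 5 = 1" and z1: "z \<noteq> 1"
    by (rule nontrivial_fifth_root_of_unity)
  have z2: "(z ^ 2) ^ 5 = 1" using z by (metis mult.commute power_mult power_one)
  have z21: "z ^ 2 \<noteq> 1"
  proof
    assume "z ^ 2 = 1"
    then have "z = 1" using z by algebra
    then show False using z1 by simp
  qed
  have "(z - 1) * (1 + z + z^2 + z^3 + z^4) = 0" using z by algebra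
  then have sum: "1 + z + z^2 + z^3 + z^4 = 0" using z1 by simp
  define c where "c = z ^ 2 + z ^ 3"
  have c': "(z ^ 2) ^ 2 + (z ^ 2) ^ 3 = - 1 - c" unfolding c_def using sum z by algebra
  have nz: "1 + (w ^ 2 + w ^ 3) * rr_cfrac s \<noteq> 0" if "w ^ 5 = 1" "w \<noteq> 1" for w
    using cyclotomic_theta_eq[OF s that] cyclotomic_theta_nonzero[OF s(1) that(1)] by auto
  show thesis
  proof (rule that[of c M])
    show "c ^ 2 + c = 1" unfolding c_def using sum z by algebra
    show "1 + c ^ 5 * rr_cfrac s ^ 5 = M * (1 + c * rr_cfrac (s ^ 5)) ^ 5"
      unfolding c_def by (rule M(2)[OF z z1])
    show "1 + (- 1 - c) ^ 5 * rr_cfrac s ^ 5 = M * (1 + (- 1 - c) * rr_cfrac (s ^ 5)) ^ 5"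
      unfolding c'[symmetric] by (rule M(2)[OF z2 z21])
    show "1 + c * rr_cfrac s \<noteq> 0" unfolding c_def by (rule nz[OF z z1])
    show "1 + (- 1 - c) * rr_cfrac s \<noteq> 0" unfolding c'[symmetric] by (rule nz[OF z2 z21])
  qed (fact M)
qed

text \<open>The quadratic splits into two conjugate factors already known to be nonzero. It guards
  the first two denominators.\<close>

lemma rr_cfrac_quadratic_nonzero:
  assumes s: "norm s < 1" "s \<noteq> 0"
  shows "1 - rr_cfrac s - rr_cfrac s ^ 2 \<noteq> 0"
proof -
  obtain c where c: "c ^ 2 + c = 1" "1 + c * rr_cfrac s \<noteq> 0" "1 + (- 1 - c) * rr_cfrac s \<noteq> 0"
    using rr_cfrac_fifth_power_cases[OF s] by metis
  have "1 - rr_cfrac s - rr_cfrac s ^ 2 = (1 + c * rr_cfrac s) * (1 + (- 1 - c) * rr_cfrac s)"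
    using c(1) by algebra
  then show ?thesis using c by simp
qed

text \<open>Reduction modulo \<open>c ^ 2 = 1 - c\<close> to the form a + c b, so that conjugation
  only exchanges \<open>c\<close> for \<open>- 1 - c\<close>.\<close>

lemma golden_fifth_power:
  fixes c :: complex
  assumes "c ^ 2 + c = 1"
  shows "c ^ 5 = 5 * c - 3"
    and "(1 + c * U) ^ 5 = (1 + 10 * U ^ 2 - 10 * U ^ 3 + 10 * U ^ 4 - 3 * U ^ 5)
           + c * (5 * U * (1 - 2 * U + 4 * U ^ 2 - 3 * U ^ 3 + U ^ 4))"
  using assms by algebra+

text \<open>Eliminating \<open>M\<close> from the two conjugate equations leaves an equation that is
  linear in r(s)^5.\<close>

lemma rr_cfrac_fifth_power:
  assumes s: "norm s < 1" "s \<noteq> 0"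
  defines "U \<equiv> rr_cfrac (s ^ 5)"
  shows "rr_cfrac s ^ 5 * (1 + 3 * U + 4 * U ^ 2 + 2 * U ^ 3 + U ^ 4)
       = U * (1 - 2 * U + 4 * U ^ 2 - 3 * U ^ 3 + U ^ 4)"
proof -
  define x where "x = rr_cfrac s ^ 5"
  obtain c M where c: "c ^ 2 + c = 1" and M: "M \<noteq> 0"
    "1 + c ^ 5 * x = M * (1 + c * U) ^ 5" "1 + (- 1 - c) ^ 5 * x = M * (1 + (- 1 - c) * U) ^ 5"
    using rr_cfrac_fifth_power_cases[OF s] unfolding U_def x_def by metis
  have c': "(- 1 - c) ^ 2 + (- 1 - c) = 1" using c by algebra
  define a b where "a = 1 + 10 * U ^ 2 - 10 * U ^ 3 + 10 * U ^ 4 - 3 * U ^ 5"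
    and "b = 5 * U * (1 - 2 * U + 4 * U ^ 2 - 3 * U ^ 3 + U ^ 4)"
  note M = M(2,3)[unfolded golden_fifth_power[OF c] golden_fifth_power[OF c'], folded a_def b_def]
  \<comment> \<open>Both sides equal \<open>M * (a + c * b) * (a + (- 1 - c) * b)\<close>.\<close>
  have "(1 + (5 * c - 3) * x) * (a + (- 1 - c) * b) = (1 + (5 * (- 1 - c) - 3) * x) * (a + c * b)"
    unfolding M by (simp add: mult_ac)
  then have "(2 * c + 1) * (x * (5 * a + 3 * b) - b) = 0"
    by algebra
  \<comment> \<open>Its square is 5.\<close>
  moreover have "2 * c + 1 \<noteq> 0"
  proof
    assume "2 * c + 1 = 0"
    then have "(5 :: complex) = 0" using c by algebra
    then show False by simp
  qed
  ultimately have "x * (5 * a + 3 * b) = b" by simp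
  moreover have "5 * a + 3 * b = 5 * (1 + 3 * U + 4 * U ^ 2 + 2 * U ^ 3 + U ^ 4)"
    unfolding a_def b_def by algebra
  ultimately show ?thesis unfolding b_def x_def by algebra
qed

text \<open>The product of the two conjugate equations writes this as M^2 (1 - U - U^2)^5 with U =
  r(s^5). It guards the third denominator.\<close>

lemma rr_cfrac_fifth_power_quadratic_nonzero:
  assumes s: "norm s < 1" "s \<noteq> 0"
  shows "1 - 11 * rr_cfrac s ^ 5 - rr_cfrac s ^ 10 \<noteq> 0"
proof -
  have s5: "norm (s ^ 5) < 1" "s ^ 5 \<noteq> 0" using s norm_power_less_one by auto
  obtain c M where c: "c ^ 2 + c = 1" and M: "M \<noteq> 0"
    "1 + c ^ 5 * rr_cfrac s ^ 5 = M * (1 + c * rr_cfrac (s ^ 5)) ^ 5"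
    "1 + (- 1 - c) ^ 5 * rr_cfrac s ^ 5 = M * (1 + (- 1 - c) * rr_cfrac (s ^ 5)) ^ 5"
    using rr_cfrac_fifth_power_cases[OF s] by metis
  define x where "x = rr_cfrac s ^ 5"
  have c': "(- 1 - c) ^ 2 + (- 1 - c) = 1" using c by algebra
  have "1 - 11 * x - x ^ 2 = (1 + (5 * c - 3) * x) * (1 + (5 * (- 1 - c) - 3) * x)"
    using c by algebra
  also have "\<dots> = M ^ 2 * ((1 + c * rr_cfrac (s ^ 5)) * (1 + (- 1 - c) * rr_cfrac (s ^ 5))) ^ 5"
    unfolding golden_fifth_power(1)[OF c, symmetric] golden_fifth_power(1)[OF c', symmetric] x_def M(2,3)
    by (simp only: power2_eq_square power_mult_distrib mult_ac)
  also have "(1 + c * rr_cfrac (s ^ 5)) * (1 + (- 1 - c) * rr_cfrac (s ^ 5))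
      = 1 - rr_cfrac (s ^ 5) - rr_cfrac (s ^ 5) ^ 2"
    using c by algebra
  finally have "1 - 11 * x - x ^ 2 \<noteq> 0"
    using M(1) rr_cfrac_quadratic_nonzero[OF s5] by simp
  then show ?thesis by (simp add: x_def power_mult[symmetric])
qed

text \<open>
  Writing \<open>k = r s * r (s ^ 2) ^ 2\<close> with \<open>r = rr_cfrac\<close>, this says \<open>k = n / d\<close> for certain polynomials
  \<open>n\<close> and \<open>d\<close> in \<open>r (s ^ 5)\<close> and \<open>r (s ^ 10)\<close>, which were found by comparing power series. The two
  sides have the same fifth power, and divided by \<open>s ^ 5\<close> both tend to \<open>1\<close> at \<open>0\<close>. One stays close to \<open>0\<close>
  because the algebraic relations between the arguments do not prevent \<open>n = d = 0\<close>.
\<close>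

lemma rr_parameter_near_0:
  "\<forall>\<^sub>F s in at 0. rr_cfrac s * rr_cfrac (s ^ 2) ^ 2
      * (1 + rr_cfrac (s ^ 10) + rr_cfrac (s ^ 10) ^ 2 + rr_cfrac (s ^ 5) * rr_cfrac (s ^ 10) ^ 2)
    = rr_cfrac (s ^ 5) - rr_cfrac (s ^ 10) + rr_cfrac (s ^ 10) ^ 2 + rr_cfrac (s ^ 5) ^ 2 * rr_cfrac (s ^ 10) ^ 2"
proof -
  define T where "T n s = rogers_ramanujan_T (s ^ n)" for n s
  define u where "u n s = rr_cfrac (s ^ n)" for n s
  note u_eq = rr_cfrac_power[folded u_def T_def]
  have T: "(T n \<longlongrightarrow> 1) (at 0)" if "n > 0" for n
    unfolding T_def using that by (rule tendsto_rogers_ramanujan_T_power)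
  have u: "(u n \<longlongrightarrow> 0) (at 0)" if "n > 0" for n
    unfolding u_def using that by (rule tendsto_rr_cfrac_power)
  define n d where "n s = u 5 s - u 10 s + u 10 s ^ 2 + u 5 s ^ 2 * u 10 s ^ 2"
    and "d s = 1 + u 10 s + u 10 s ^ 2 + u 5 s * u 10 s ^ 2" for s
  \<comment> \<open>These are \<open>u 1 s * u 2 s ^ 2 * d s\<close> and \<open>n s\<close> divided
    by \<open>s ^ 5\<close>; both tend to 1.\<close>
  define \<alpha> \<beta> where "\<alpha> s = T 5 s * T 10 s ^ 2 * d s"
    and "\<beta> s = T 25 s - s ^ 5 * T 50 s + s ^ 15 * T 50 s ^ 2 + s ^ 25 * T 25 s ^ 2 * T 50 s ^ 2" for s
  \<comment> \<open>The polynomial multiplying r(s)^5 in the degree 5 equation; it is 1 at 0, hence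
    cancellable nearby.\<close>
  define B where "B x = 1 + 3 * x + 4 * x ^ 2 + 2 * x ^ 3 + x ^ 4" for x :: complex
  have lim_n: "(n \<longlongrightarrow> 0 - 0 + 0 ^ 2 + 0 ^ 2 * 0 ^ 2) (at 0)"
    unfolding n_def by (intro tendsto_intros u) auto
  have lim_d: "(d \<longlongrightarrow> 1 + 0 + 0 ^ 2 + 0 * 0 ^ 2) (at 0)"
    unfolding d_def by (intro tendsto_intros u) auto
  have lim_B: "((\<lambda>s. B (u m s)) \<longlongrightarrow> 1 + 3 * 0 + 4 * 0 ^ 2 + 2 * 0 ^ 3 + 0 ^ 4) (at 0)" if "m > 0" for m
    unfolding B_def using that by (intro tendsto_intros u) auto
  have lim_a: "(\<alpha> \<longlongrightarrow> 1 * 1 ^ 2 * 1) (at 0)"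
    unfolding \<alpha>_def using lim_d by (intro tendsto_intros T) auto
  have lim_b: "(\<beta> \<longlongrightarrow> 1 - 0 ^ 5 * 1 + 0 ^ 15 * 1 ^ 2 + 0 ^ 25 * 1 ^ 2 * 1 ^ 2) (at 0)"
    unfolding \<beta>_def by (intro tendsto_intros T) auto
  \<comment> \<open>The cofactor of \<alpha> - \<beta> in \<alpha>^5 - \<beta>^5. Its limit is 5, so
    equality of fifth powers gives equality, with no ambiguity by a root of unity.\<close>
  have lim_ab: "((\<lambda>s. \<alpha> s ^ 4 + \<alpha> s ^ 3 * \<beta> s + \<alpha> s ^ 2 * \<beta> s ^ 2 + \<alpha> s * \<beta> s ^ 3 + \<beta> s ^ 4)
      \<longlongrightarrow> 1 ^ 4 + 1 ^ 3 * 1 + 1 ^ 2 * 1 ^ 2 + 1 * 1 ^ 3 + 1 ^ 4) (at 0)"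
    using lim_a lim_b by (intro tendsto_intros) auto
  have "\<forall>\<^sub>F s in at 0. d s + n s \<noteq> 0"
    by (rule tendsto_imp_eventually_ne[OF tendsto_add[OF lim_d lim_n]]) simp
  moreover have "\<forall>\<^sub>F s in at 0. d s - n s \<noteq> 0"
    by (rule tendsto_imp_eventually_ne[OF tendsto_diff[OF lim_d lim_n]]) simp
  moreover have "\<forall>\<^sub>F s in at 0. B (u 5 s) \<noteq> 0"
    by (rule tendsto_imp_eventually_ne[OF lim_B]) simp_all
  moreover have "\<forall>\<^sub>F s in at 0. B (u 10 s) \<noteq> 0"
    by (rule tendsto_imp_eventually_ne[OF lim_B]) simp_all
  moreover have "\<forall>\<^sub>F s in at 0. \<alpha> s ^ 4 + \<alpha> s ^ 3 * \<beta> s + \<alpha> s ^ 2 * \<beta> s ^ 2 + \<alpha> s * \<beta> s ^ 3 + \<beta> s ^ 4 \<noteq> 0"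
    by (rule tendsto_imp_eventually_ne[OF lim_ab]) simp_all
  moreover have "\<forall>\<^sub>F s in at (0::complex). s \<noteq> 0 \<and> norm s < 1"
    unfolding eventually_at by (rule exI[of _ 1]) auto
  ultimately have "\<forall>\<^sub>F s in at 0. u 1 s * u 2 s ^ 2 * d s = n s"
  proof eventually_elim
    case (elim s)
    then have s: "norm s < 1" "s \<noteq> 0" by auto
    have s2: "norm (s ^ 2) < 1" "s ^ 2 \<noteq> 0" and s5: "norm (s ^ 5) < 1" "s ^ 5 \<noteq> 0"
      using s norm_power_less_one by auto
    define x y U V where "x = u 1 s ^ 5" and "y = u 2 s ^ 5" and "U = u 5 s" and "V = u 10 s"
    define n' d' where "n' = n s" and "d' = d s"
    have n': "n' = U - V + V ^ 2 + U ^ 2 * V ^ 2" and d': "d' = 1 + V + V ^ 2 + U * V ^ 2"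
      by (simp_all add: n'_def d'_def U_def V_def n_def d_def)
    have P: "V - U ^ 2 = (V + U ^ 2) * (U * V ^ 2)"
      using rr_cfrac_degree_2(1)[OF s5] by (simp add: U_def V_def u_def power_mult[symmetric])
    have x: "x * B U = U * (1 - 2 * U + 4 * U ^ 2 - 3 * U ^ 3 + U ^ 4)"
      using rr_cfrac_fifth_power[OF s] by (simp add: B_def U_def x_def u_def)
    have y: "y * B V = V * (1 - 2 * V + 4 * V ^ 2 - 3 * V ^ 3 + V ^ 4)"
      using rr_cfrac_fifth_power[OF s2] by (simp add: B_def V_def y_def u_def power_mult[symmetric])
    have "B U * (n' * (d' - n') ^ 2) = B U * (x * (d' + n') ^ 2 * d')"
      using param_fifth_power_1[OF P, folded n' d' B_def] unfolding x[symmetric] by (simp add: mult_ac)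
    then have i: "n' * (d' - n') ^ 2 = x * (d' + n') ^ 2 * d'"
      using elim by (simp add: U_def)
    have "B V * (y * (d' - n') * d' ^ 2) = B V * (n' ^ 2 * (d' + n'))"
      using param_fifth_power_2[OF P, folded n' d' B_def] unfolding y[symmetric] by (simp add: mult_ac)
    then have ii: "y * (d' - n') * d' ^ 2 = n' ^ 2 * (d' + n')"
      using elim by (simp add: V_def)
    \<comment> \<open>In terms of k = n/d: k (1 - k)^2 / (1 + k)^2 times the square of k^2 (1 + k) /
      (1 - k) is k^5.\<close>
    have "(d' + n') ^ 2 * (d' - n') ^ 2 * (x * y ^ 2 * d' ^ 5)
        = (x * (d' + n') ^ 2 * d') * (y * (d' - n') * d' ^ 2) ^ 2"
      by algebra
    also have "\<dots> = (d' + n') ^ 2 * (d' - n') ^ 2 * n' ^ 5"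
      unfolding ii i[symmetric] by algebra
    finally have "x * y ^ 2 * d' ^ 5 = n' ^ 5"
      using elim by (simp add: n'_def d'_def)
    moreover have "u 1 s * u 2 s ^ 2 * d s = s ^ 5 * \<alpha> s"
      unfolding u_eq \<alpha>_def by (simp add: eval_nat_numeral)
    moreover have "n s = s ^ 5 * \<beta> s"
      unfolding n_def \<beta>_def u_eq by (simp add: algebra_simps power_mult_distrib power_add[symmetric] power_mult[symmetric])
    moreover have "x * y ^ 2 * d' ^ 5 = (u 1 s * u 2 s ^ 2 * d s) ^ 5"
      by (simp add: x_def y_def d'_def power_mult_distrib power_mult[symmetric])
    ultimately have "(s ^ 5) ^ 5 * (\<alpha> s ^ 5 - \<beta> s ^ 5) = 0"
      by (auto simp add: n'_def power_mult_distrib algebra_simps)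
    then have "(\<alpha> s - \<beta> s) * (\<alpha> s ^ 4 + \<alpha> s ^ 3 * \<beta> s + \<alpha> s ^ 2 * \<beta> s ^ 2 + \<alpha> s * \<beta> s ^ 3 + \<beta> s ^ 4) = 0"
      using s by (simp add: algebra_simps eval_nat_numeral)
    then have "\<alpha> s = \<beta> s" using elim by simp
    then show ?case
      using \<open>u 1 s * u 2 s ^ 2 * d s = s ^ 5 * \<alpha> s\<close> \<open>n s = s ^ 5 * \<beta> s\<close> by simp
  qed
  then show ?thesis by (simp add: u_def n_def d_def)
qed

text \<open>The parameter formula at \<open>s\<close> and at \<open>s ^ 2\<close>, together with the
  degree 4 relation, reduces everything to the polynomial relations above. Near 0 all factors to be
  cancelled are nonzero.\<close>

lemma rr_cfrac_identities_near_0: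
  "\<forall>\<^sub>F s in at 0.
     (let g = rr_cfrac s * rr_cfrac (s ^ 4); k = rr_cfrac s * rr_cfrac (s ^ 2) ^ 2;
          U = rr_cfrac (s ^ 5); V = rr_cfrac (s ^ 10); W = rr_cfrac (s ^ 20)
      in (1 + U + W) * g = U + W - U * W
       \<and> rr_cfrac s ^ 2 * rr_cfrac (s ^ 2) * (U * V + W + U * W) = rr_cfrac (s ^ 4) * (U * (V - U * V + W))
       \<and> (1 - k ^ 2) * param_den U V = param_num U V * k)"
proof -
  define u where "u n s = rr_cfrac (s ^ n)" for n s
  have u: "(u n \<longlongrightarrow> 0) (at 0)" if "n > 0" for n
    unfolding u_def using that by (rule tendsto_rr_cfrac_power)
  define F where "F s \<longleftrightarrow> u 1 s * u 2 s ^ 2 * (1 + u 10 s + u 10 s ^ 2 + u 5 s * u 10 s ^ 2)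
      = u 5 s - u 10 s + u 10 s ^ 2 + u 5 s ^ 2 * u 10 s ^ 2" for s
  have F: "\<forall>\<^sub>F s in at 0. F s"
    using rr_parameter_near_0 by (simp add: F_def u_def)
  have "filterlim (\<lambda>s::complex. s ^ 2) (at 0) (at 0)"
    by (auto simp: filterlim_at eventually_at intro!: tendsto_eq_intros exI[of _ 1])
  then have F2: "\<forall>\<^sub>F s in at 0. F (s ^ 2)"
    using F by (rule eventually_compose_filterlim[rotated])
  have lim: "((\<lambda>s. 1 + u 10 s + u 10 s ^ 2 + u 5 s * u 10 s ^ 2) \<longlongrightarrow> 1 + 0 + 0 ^ 2 + 0 * 0 ^ 2) (at 0)"
    "((\<lambda>s. 1 + u 20 s + u 20 s ^ 2 + u 10 s * u 20 s ^ 2) \<longlongrightarrow> 1 + 0 + 0 ^ 2 + 0 * 0 ^ 2) (at 0)"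
    "((\<lambda>s. 1 + u 10 s - u 10 s ^ 2 * u 20 s) \<longlongrightarrow> 1 + 0 - 0 ^ 2 * 0) (at 0)"
    "((\<lambda>s. 1 + u 1 s * u 2 s ^ 2) \<longlongrightarrow> 1 + 0 * 0 ^ 2) (at 0)"
    "((\<lambda>s. 1 + u 5 s + u 20 s) \<longlongrightarrow> 1 + 0 + 0) (at 0)"
    by (intro tendsto_intros u; simp)+
  have "\<forall>\<^sub>F s in at 0. 1 + u 10 s + u 10 s ^ 2 + u 5 s * u 10 s ^ 2 \<noteq> 0"
    by (rule tendsto_imp_eventually_ne[OF lim(1)]) simp
  moreover have "\<forall>\<^sub>F s in at 0. 1 + u 20 s + u 20 s ^ 2 + u 10 s * u 20 s ^ 2 \<noteq> 0"
    by (rule tendsto_imp_eventually_ne[OF lim(2)]) simp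
  moreover have "\<forall>\<^sub>F s in at 0. 1 + u 10 s - u 10 s ^ 2 * u 20 s \<noteq> 0"
    by (rule tendsto_imp_eventually_ne[OF lim(3)]) simp
  moreover have "\<forall>\<^sub>F s in at 0. 1 + u 1 s * u 2 s ^ 2 \<noteq> 0"
    by (rule tendsto_imp_eventually_ne[OF lim(4)]) simp
  moreover have "\<forall>\<^sub>F s in at 0. 1 + u 5 s + u 20 s \<noteq> 0"
    by (rule tendsto_imp_eventually_ne[OF lim(5)]) simp
  moreover have "\<forall>\<^sub>F s in at (0::complex). s \<noteq> 0 \<and> norm s < 1"
    unfolding eventually_at by (rule exI[of _ 1]) auto
  ultimately show ?thesis
    using F F2
  proof eventually_elim
    case (elim s)
    then have s: "norm s < 1" "s \<noteq> 0" by auto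
    have s2: "norm (s ^ 2) < 1" "s ^ 2 \<noteq> 0" and s4: "norm (s ^ 4) < 1" "s ^ 4 \<noteq> 0"
      and s5: "norm (s ^ 5) < 1" "s ^ 5 \<noteq> 0" and s10: "norm (s ^ 10) < 1" "s ^ 10 \<noteq> 0"
      using s norm_power_less_one by auto
    define r v w U V W where "r = rr_cfrac s" and "v = rr_cfrac (s ^ 2)" and "w = rr_cfrac (s ^ 4)"
      and "U = rr_cfrac (s ^ 5)" and "V = rr_cfrac (s ^ 10)" and "W = rr_cfrac (s ^ 20)"
    note defs = r_def v_def w_def U_def V_def W_def
    define g k l where "g = r * w" and "k = r * v ^ 2" and "l = v * w ^ 2"
    define n d where "n = U - V + V ^ 2 + U ^ 2 * V ^ 2" and "d = 1 + V + V ^ 2 + U * V ^ 2"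
    define n' d' where "n' = V * (1 - 2 * W + W ^ 2 + V * W)" and "d' = 1 + V - V ^ 2 * W"
    have nz: "v \<noteq> 0" "w \<noteq> 0" unfolding defs using rr_cfrac_nonzero s2 s4 by auto
    have d0: "d \<noteq> 0" "d' \<noteq> 0" "1 + k \<noteq> 0" "1 + U + W \<noteq> 0"
      using elim by (auto simp: d_def d'_def k_def defs u_def)
    have P: "V - U ^ 2 = (V + U ^ 2) * (U * V ^ 2)" "W - V ^ 2 = (W + V ^ 2) * (V * W ^ 2)"
      "U * W * (1 + U * V ^ 2) = U * V ^ 2 + V * W ^ 2"
      using rr_cfrac_degree_2(1)[OF s5] rr_cfrac_degree_2(1)[OF s10] rr_cfrac_degree_2(2)[OF s5]
      by (simp_all add: defs power_mult[symmetric])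
    have gk: "g * (1 + k) = k + l"
      using rr_cfrac_degree_2(2)[OF s] by (simp add: g_def k_def l_def defs)
    have k: "k * d = n"
      using elim by (simp add: F_def k_def d_def n_def defs u_def)
    \<comment> \<open>\<open>l\<close> is the parameter at \<open>s ^ 2\<close>; its quotient is the
      one for \<open>k\<close> taken at (V, W), simplified by the modular equation between V and
      W.\<close>
    have l: "l * d' = n'"
    proof -
      have "l * (1 + W + W ^ 2 + V * W ^ 2) = V - W + W ^ 2 + V ^ 2 * W ^ 2"
        using elim by (simp add: F_def l_def defs u_def power_mult[symmetric])
      then have "(1 + W + W ^ 2 + V * W ^ 2) * (l * d' - n') = 0"
        unfolding d'_def n'_def using P(2) by algebra
      moreover have "1 + W + W ^ 2 + V * W ^ 2 \<noteq> 0"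
        using elim by (simp add: defs u_def)
      ultimately show ?thesis by simp
    qed
    have "d * d' * (1 + k) * ((1 + U + W) * g - (U + W - U * W)) = 0"
      using param_relation_product[OF P, folded n_def d_def n'_def d'_def] gk k l by algebra
    then have 1: "(1 + U + W) * g = U + W - U * W"
      using d0 by simp
    \<comment> \<open>Works because k g / l = r^2 v / w.\<close>
    have "d * d' * (1 + U + W) * (k * g * (U * V + W + U * W) - l * (U * (V - U * V + W))) = 0"
      using param_relation_quotient[OF P, folded n_def d_def n'_def d'_def] 1 k l by algebra
    then have "k * g * (U * V + W + U * W) = l * (U * (V - U * V + W))"
      using d0 by simp
    then have "v * w * (r ^ 2 * v * (U * V + W + U * W) - w * (U * (V - U * V + W))) = 0"
      unfolding k_def g_def l_def by algebra
    then have 2: "r ^ 2 * v * (U * V + W + U * W) = w * (U * (V - U * V + W))"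
      using nz by simp
    have "d ^ 2 * ((1 - k ^ 2) * param_den U V - param_num U V * k) = 0"
      using param_relation[OF P(1), folded n_def d_def] k by algebra
    then have 3: "(1 - k ^ 2) * param_den U V = param_num U V * k" using d0 by simp
    from 1 2 3 show ?case
      unfolding Let_def g_def k_def defs by blast
  qed
qed

section \<open>Extension to the unit disc and nonvanishing denominators\<close>

lemma holomorphic_eq_0_if_near_0:
  assumes "f holomorphic_on ball 0 1" "\<forall>\<^sub>F s in at 0. f s = 0" "norm s < 1"
  shows "f s = (0 :: complex)"
proof -
  obtain e where e: "e > 0" "\<And>s. s \<noteq> 0 \<Longrightarrow> dist s 0 < e \<Longrightarrow> f s = 0"
    using assms(2) unfolding eventually_at by auto
  show ?thesis
  proof (rule analytic_continuation[OF assms(1)])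
    show "0 islimpt (ball 0 (min e 1) - {0 :: complex})"
      using e(1) by (simp add: islimpt_ball islimpt_punctured[symmetric])
  qed (use e assms(3) in auto)
qed

text \<open>Without denominators, the difference of the two sides is holomorphic on the whole disc,
  so its vanishing near 0 propagates.\<close>

lemma rr_cfrac_identities:
  assumes s: "norm s < 1" "s \<noteq> 0"
  defines "U \<equiv> rr_cfrac (s ^ 5)" and "V \<equiv> rr_cfrac (s ^ 10)" and "W \<equiv> rr_cfrac (s ^ 20)"
    and "k \<equiv> rr_cfrac s * rr_cfrac (s ^ 2) ^ 2"
  shows "(1 + U + W) * (rr_cfrac s * rr_cfrac (s ^ 4)) = U + W - U * W"
    and "rr_cfrac s ^ 2 * rr_cfrac (s ^ 2) * (U * V + W + U * W) = rr_cfrac (s ^ 4) * (U * (V - U * V + W))"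
    and "(1 - k ^ 2) * param_den U V = param_num U V * k"
proof -
  have hol: "(\<lambda>s. rr_cfrac (s ^ n)) holomorphic_on ball 0 1" if "n > 0" for n
    using that by (rule holomorphic_rr_cfrac_power)
  have hol1: "rr_cfrac holomorphic_on ball 0 1" using hol[of 1] by simp
  note ev = rr_cfrac_identities_near_0[unfolded Let_def]
  have "(\<lambda>s. (1 + rr_cfrac (s ^ 5) + rr_cfrac (s ^ 20)) * (rr_cfrac s * rr_cfrac (s ^ 4))
      - (rr_cfrac (s ^ 5) + rr_cfrac (s ^ 20) - rr_cfrac (s ^ 5) * rr_cfrac (s ^ 20))) s = 0"
    by (rule holomorphic_eq_0_if_near_0[OF _ _ s(1)])
       (auto intro!: holomorphic_intros hol hol1 eventually_mono[OF ev])
  then show "(1 + U + W) * (rr_cfrac s * rr_cfrac (s ^ 4)) = U + W - U * W"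
    by (simp add: U_def W_def)
  have "(\<lambda>s. rr_cfrac s ^ 2 * rr_cfrac (s ^ 2) * (rr_cfrac (s ^ 5) * rr_cfrac (s ^ 10) + rr_cfrac (s ^ 20) + rr_cfrac (s ^ 5) * rr_cfrac (s ^ 20))
      - rr_cfrac (s ^ 4) * (rr_cfrac (s ^ 5) * (rr_cfrac (s ^ 10) - rr_cfrac (s ^ 5) * rr_cfrac (s ^ 10) + rr_cfrac (s ^ 20)))) s = 0"
    by (rule holomorphic_eq_0_if_near_0[OF _ _ s(1)])
       (auto intro!: holomorphic_intros hol hol1 eventually_mono[OF ev])
  then show "rr_cfrac s ^ 2 * rr_cfrac (s ^ 2) * (U * V + W + U * W) = rr_cfrac (s ^ 4) * (U * (V - U * V + W))"
    by (simp add: U_def V_def W_def)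
  have "(\<lambda>s. (1 - (rr_cfrac s * rr_cfrac (s ^ 2) ^ 2) ^ 2) * param_den (rr_cfrac (s ^ 5)) (rr_cfrac (s ^ 10))
      - param_num (rr_cfrac (s ^ 5)) (rr_cfrac (s ^ 10)) * (rr_cfrac s * rr_cfrac (s ^ 2) ^ 2)) s = 0"
    (is "?f s = 0")
  proof (rule holomorphic_eq_0_if_near_0[OF _ _ s(1)])
    show "?f holomorphic_on ball 0 1"
      unfolding param_den_def param_num_def by (intro holomorphic_intros hol hol1) simp_all
    show "\<forall>\<^sub>F s in at 0. ?f s = 0"
      using ev by eventually_elim simp
  qed
  then show "(1 - k ^ 2) * param_den U V = param_num U V * k"
    by (simp add: U_def V_def k_def)
qed

theorem theorem1p1:
  fixes q s N D :: complex and R :: "nat \<Rightarrow> complex"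
  assumes q: "0 < norm q" "norm q < 1"
    and fifth_root: "s ^ 5 = q"
    and R: "\<And>n. n > 0 \<Longrightarrow> R n = s ^ n * rogers_ramanujan_T (q ^ n)"
    and D: "D = R 5 * (1 + R 5 * R 10 ^ 2 - R 5 ^ 2 * R 10 ^ 4)"
    and N: "N = 1 + R 5 + R 5 ^ 2 + 2 * R 5 * R 10 + 2 * R 5 ^ 2 * R 10 - 2 * R 5 * R 10 ^ 2
              + 2 * R 5 ^ 3 * R 10 ^ 2 - 2 * R 5 ^ 2 * R 10 ^ 3 + 2 * R 5 ^ 3 * R 10 ^ 3
              + R 5 ^ 2 * R 10 ^ 4 - R 5 ^ 3 * R 10 ^ 4 + R 5 ^ 4 * R 10 ^ 4"
  shows "(1 + R 5 + R 20 \<noteq> 0 \<and>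
          R 1 * R 4 = (R 5 + R 20 - R 5 * R 20) / (1 + R 5 + R 20))
       \<and> (R 5 * R 10 + R 20 + R 5 * R 20 \<noteq> 0 \<and>
          R 1 ^ 2 * R 2 / R 4 =
            R 5 * ((R 10 - R 5 * R 10 + R 20) / (R 5 * R 10 + R 20 + R 5 * R 20)))
       \<and> (D \<noteq> 0 \<and>
          1 / (R 1 * R 2 ^ 2) - R 1 * R 2 ^ 2 = N / D)"
proof -
  have s0: "s \<noteq> 0" using q fifth_root by auto
  have s1: "norm s < 1"
  proof (rule ccontr)
    assume "\<not> norm s < 1"
    then have "1 \<le> norm s ^ 5" by (intro one_le_power) simp
    then show False using q fifth_root by (metis norm_power not_less)
  qed
  note s = s1 s0
  have R': "R n = rr_cfrac (s ^ n)" if "n > 0" for n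
    unfolding R[OF that] rr_cfrac_power fifth_root[symmetric] by (simp add: power_mult[symmetric])
  have sn: "norm (s ^ n) < 1" "s ^ n \<noteq> 0" if "n > 0" for n
    using s that norm_power_less_one by auto
  have nz: "R n \<noteq> 0" if "n > 0" for n
    unfolding R'[OF that] by (rule rr_cfrac_nonzero[OF sn[OF that]])
  define U V W where "U = R 5" and "V = R 10" and "W = R 20"
  have Q: "1 - U - U ^ 2 \<noteq> 0"
    unfolding U_def R'[of 5, simplified] by (rule rr_cfrac_quadratic_nonzero[OF sn]) simp_all
  have Q5: "1 - 11 * U ^ 5 - U ^ 10 \<noteq> 0"
    unfolding U_def R'[of 5, simplified] by (rule rr_cfrac_fifth_power_quadratic_nonzero[OF sn]) simp_all
  have P: "V - U ^ 2 = (V + U ^ 2) * (U * V ^ 2)"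
    using rr_cfrac_degree_2(1)[OF sn, of 5] by (simp add: U_def V_def R' power_mult[symmetric])
  have UVW: "U \<noteq> 0" "V \<noteq> 0" "W \<noteq> 0" unfolding U_def V_def W_def using nz by simp_all
  have I: "(1 + U + W) * (R 1 * R 4) = U + W - U * W"
    "R 1 ^ 2 * R 2 * (U * V + W + U * W) = R 4 * (U * (V - U * V + W))"
    "(1 - (R 1 * R 2 ^ 2) ^ 2) * D = N * (R 1 * R 2 ^ 2)"
    using rr_cfrac_identities[OF s] unfolding D N U_def V_def W_def param_den_def param_num_def by (simp_all add: R')
  \<comment> \<open>If it vanished, the numerator would vanish too; substituting W = -1 - U in the
    numerator gives U^2 + U - 1 = 0.\<close>
  have 1: "1 + U + W \<noteq> 0"
  proof
    assume "1 + U + W = 0"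
    then have "1 - U - U ^ 2 = 0" using I(1) by algebra
    then show False using Q by simp
  qed
  \<comment> \<open>Again both numerator and denominator would vanish; eliminating W leaves V (1 - U
    - U^2) = 0.\<close>
  have 2: "U * V + W + U * W \<noteq> 0"
  proof
    assume a: "U * V + W + U * W = 0"
    then have "V - U * V + W = 0" using I(2) nz[of 4] UVW by simp
    then have "V * (1 - U - U ^ 2) = 0" using a by algebra
    then show False using Q UVW by simp
  qed
  \<comment> \<open>With k = U V^2 a zero means k^2 = 1 + k. The modular equation gives U^5 (1 +
    k)^2 = k (1 - k)^2, which then reduces to U^5 = (k - 1) / (3k + 2), a root of 1 - 11 X -
    X^2.\<close>
  have 3: "1 + U * V ^ 2 - U ^ 2 * V ^ 4 \<noteq> 0"
  proof
    define k where "k = U * V ^ 2"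
    assume "1 + U * V ^ 2 - U ^ 2 * V ^ 4 = 0"
    then have k: "k ^ 2 = 1 + k" unfolding k_def by algebra
    have "U ^ 5 * (1 + k) ^ 2 = k * (1 - k) ^ 2"
      using P unfolding k_def by algebra
    then have "U ^ 5 * (3 * k + 2) = k - 1"
      using k by algebra
    then have "(3 * k + 2) ^ 2 * (1 - 11 * U ^ 5 - U ^ 10) = 0"
      using k by algebra
    then have "3 * k + 2 = 0" using Q5 by simp
    then have "(1 :: complex) = 0" using k by algebra
    then show False by simp
  qed
  have D0: "D \<noteq> 0" using 3 UVW unfolding D U_def V_def by simp
  have "R 1 * R 4 = (U + W - U * W) / (1 + U + W)"
    using I(1) 1 by (simp add: field_simps)
  moreover have "R 1 ^ 2 * R 2 / R 4 = U * ((V - U * V + W) / (U * V + W + U * W))"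
    using I(2) 2 nz[of 4] by (simp add: divide_simps mult_ac)
  moreover have "1 / (R 1 * R 2 ^ 2) - R 1 * R 2 ^ 2 = N / D"
  proof -
    have "1 / k - k = N / D" if "k \<noteq> 0" "(1 - k ^ 2) * D = N * k" for k
      using that D0 by (simp add: field_simps power2_eq_square)
    then show ?thesis using I(3) nz[of 1] nz[of 2] by simp
  qed
  ultimately show ?thesis
    using 1 2 D0 unfolding U_def V_def W_def by blast
qed

end
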